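(* Let $A,B\in\mathbb{R}$ with $-1\le B<A\le 1$, and let $f\in\mathcal{C}(A,B)$, $f(z)=z+\sum_{n\ge 2}a_nz^n$. Put $$\mu=\frac{B-5A}{2},\qquad \nu=\frac{3A^2-AB}{2}.$$ Then the first three logarithmic inverse coefficients of $f$ satisfy the following sharp estimates: $$|\Gamma_1|\le \frac{A-B}{4},$$ $$|\Gamma_2|\le\begin{cases}\dfrac{A-B}{12}, & |5A-B|\le 4,\\[2mm] \dfrac{(A-B)|5A-B|}{48}, & |5A-B|>4,\end{cases}$$ $$|\Gamma_3|\le\begin{cases}\dfrac{A-B}{24}, & (\mu,\nu)\in D_1\cup D_2,\\[2mm] \dfrac{(A-B)\,|A(3A-B)|}{48}, & (\mu,\nu)\in D_6,\\[2mm] \dfrac{(A-B)(|B-5A|+2)^{3/2}}{72\sqrt{3(|B-5A|+2+3A^2-AB)}}, & (\mu,\nu)\in D_8\cup D_9.\end{cases}$$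
   Context: Let $\mathbb{D}=\{z\in\mathbb{C}:|z|<1\}$ and let $\mathcal{A}$ be the class of holomorphic functions $f$ on $\mathbb{D}$ with $f(0)=0$, $f'(0)=1$, i.e. $f(z)=z+\sum_{n=2}^\infty a_nz^n$. For holomorphic $g,h$ on $\mathbb{D}$, $g\prec h$ (subordination) means there is a holomorphic $\omega:\mathbb{D}\to\mathbb{D}$ with $\omega(0)=0$ and $g=h\circ\omega$. For $-1\le B<A\le1$, the Janowski convex class is $$\mathcal{C}(A,B)=\Big\{f\in\mathcal{A}: 1+\frac{zf''(z)}{f'(z)}\prec\frac{1+Az}{1+Bz}\Big\}.$$ Functions in $\mathcal{C}(A,B)$ are univalent. The logarithmic inverse coefficients $\Gamma_n$ of $f$ are defined by $\log\frac{f^{-1}(w)}{w}=2\sum_{n=1}^\infty\Gamma_nw^n$ for $|w|<1/4$; in particular $$\Gamma_1=-\tfrac12a_2,\quad \Gamma_2=-\tfrac12\big(a_3-\tfrac32a_2^2\big),\quad \Gamma_3=-\tfrac12\big(a_4-4a_2a_3+\tfrac{10}{3}a_2^3\big).$$ The regions in the real $(\mu,\nu)$-plane are: $$D_1=\{|\mu|\le\tfrac12,\ \nu\le1\},$$ $$D_2=\{\tfrac12\le|\mu|\le2,\ \tfrac4{27}(|\mu|+1)^3-(|\mu|+1)\le\nu\le1\},$$ $$D_6=\{2\le|\mu|\le4,\ \nu\ge\tfrac1{12}(\mu^2+8)\},$$ $$D_8=\{\tfrac12\le|\mu|\le2,\ -\tfrac23(|\mu|+1)\le\nu\le\tfrac4{27}(|\mu|+1)^3-(|\mu|+1)\},$$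 $$D_9=\Big\{|\mu|\ge2,\ -\tfrac23(|\mu|+1)\le\nu\le\frac{2|\mu|(|\mu|+1)}{\mu^2+2|\mu|+4}\Big\}.$$ "Sharp" means that for each admissible $(A,B)$ falling in the indicated case, there is a function $f\in\mathcal{C}(A,B)$ for which equality holds in the corresponding estimate. *)

theory Defs
  imports "HOL-Complex_Analysis.Complex_Analysis"
begin

definition normalized_class :: "(complex \<Rightarrow> complex) set" where
  "normalized_class = {f. f holomorphic_on ball 0 1 \<and> f 0 = 0 \<and> deriv f 0 = 1}"

definition subordinate :: "(complex \<Rightarrow> complex) \<Rightarrow> (complex \<Rightarrow> complex) \<Rightarrow> bool" where
  "subordinate g h \<longleftrightarrow>
     g holomorphic_on ball 0 1 \<and> h holomorphic_on ball 0 1 \<and>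
     (\<exists>w. w holomorphic_on ball 0 1 \<and> w ` ball 0 1 \<subseteq> ball 0 1 \<and> w 0 = 0 \<and>
          (\<forall>z\<in>ball 0 1. g z = h (w z)))"

text \<open>The condition that the derivative has no zeros is what makes the quotient
  \<open>z f'' / f'\<close> a genuine function on the disk; it excludes the HOL convention \<open>x / 0 = 0\<close>.\<close>

definition janowski_convex :: "real \<Rightarrow> real \<Rightarrow> (complex \<Rightarrow> complex) set" where
  "janowski_convex A B =
     {f \<in> normalized_class.
        (\<forall>z\<in>ball 0 1. deriv f z \<noteq> 0) \<and>
        subordinate (\<lambda>z. 1 + z * deriv (deriv f) z / deriv f z)
                    (\<lambda>z. (1 + of_real A * z) / (1 + of_real B * z))}"

text \<open>The function \<open>w \<mapsto> log (f\<inverse>(w) / w)\<close>, where \<open>f\<inverse>\<close> inverts the univalent \<open>f\<close> on the unit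
  disk.  Since \<open>f\<inverse>(w) / w \<longlongrightarrow> 1\<close> as \<open>w \<longlongrightarrow> 0\<close>, the singularity at \<open>0\<close> is removable with value
  \<open>log 1 = 0\<close>, and the principal branch is the intended one near \<open>0\<close>.\<close>

definition log_inverse :: "(complex \<Rightarrow> complex) \<Rightarrow> complex \<Rightarrow> complex" where
  "log_inverse f w = (if w = 0 then 0 else Ln (inv_into (ball 0 1) f w / w))"

text \<open>\<open>log (f\<inverse>(w) / w) = 2 (\<Gamma>\<^sub>1 w + \<Gamma>\<^sub>2 w\<^sup>2 + \<dots>)\<close>, so that \<open>2 \<Gamma>\<^sub>n\<close> is the \<open>n\<close>-th Taylor
  coefficient at \<open>0\<close>.\<close>

definition log_inverse_coeff :: "(complex \<Rightarrow> complex) \<Rightarrow> nat \<Rightarrow> complex" where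
  "log_inverse_coeff f n = fps_nth (fps_expansion (log_inverse f) 0) n / 2"

definition D1 :: "(real \<times> real) set" where
  "D1 = {(\<mu>, \<nu>). \<bar>\<mu>\<bar> \<le> 1/2 \<and> \<nu> \<le> 1}"

definition D2 :: "(real \<times> real) set" where
  "D2 = {(\<mu>, \<nu>). 1/2 \<le> \<bar>\<mu>\<bar> \<and> \<bar>\<mu>\<bar> \<le> 2 \<and>
           4/27 * (\<bar>\<mu>\<bar> + 1)^3 - (\<bar>\<mu>\<bar> + 1) \<le> \<nu> \<and> \<nu> \<le> 1}"

definition D6 :: "(real \<times> real) set" where
  "D6 = {(\<mu>, \<nu>). 2 \<le> \<bar>\<mu>\<bar> \<and> \<bar>\<mu>\<bar> \<le> 4 \<and> \<nu> \<ge> 1/12 * (\<mu>^2 + 8)}"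

definition D8 :: "(real \<times> real) set" where
  "D8 = {(\<mu>, \<nu>). 1/2 \<le> \<bar>\<mu>\<bar> \<and> \<bar>\<mu>\<bar> \<le> 2 \<and>
           - 2/3 * (\<bar>\<mu>\<bar> + 1) \<le> \<nu> \<and> \<nu> \<le> 4/27 * (\<bar>\<mu>\<bar> + 1)^3 - (\<bar>\<mu>\<bar> + 1)}"

definition D9 :: "(real \<times> real) set" where
  "D9 = {(\<mu>, \<nu>). \<bar>\<mu>\<bar> \<ge> 2 \<and> - 2/3 * (\<bar>\<mu>\<bar> + 1) \<le> \<nu> \<and>
           \<nu> \<le> 2 * \<bar>\<mu>\<bar> * (\<bar>\<mu>\<bar> + 1) / (\<mu>^2 + 2 * \<bar>\<mu>\<bar> + 4)}"

definition sharp_bound :: "'a set \<Rightarrow> ('a \<Rightarrow> real) \<Rightarrow> real \<Rightarrow> bool" where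
  "sharp_bound S F b \<longleftrightarrow> (\<forall>f\<in>S. F f \<le> b) \<and> (\<exists>f\<in>S. F f = b)"

end

theory Submission
  imports Defs
begin

text \<open>
  Let \<open>f\<close> be Janowski convex and let \<open>\<omega>\<close> be the Schwarz function of the subordination. Then
  \<open>z f'' (1 + B \<omega>) = (A - B) \<omega> f'\<close>, so the Taylor coefficients of \<open>f\<close>, and with them the numbers
  \<open>\<Gamma>\<^sub>n\<close>, are polynomials in the coefficients \<open>c\<^sub>n\<close> of \<open>\<omega>\<close>. Up to the factors
  \<open>- (A - B) / 4\<close>, \<open>- (A - B) / 12\<close>, \<open>- (A - B) / 24\<close> they are
  \<open>c\<^sub>1\<close>, \<open>c\<^sub>2 - (5 A - B) / 4 c\<^sub>1\<^sup>2\<close> and \<open>c\<^sub>3 + \<mu> c\<^sub>1 c\<^sub>2 + \<nu> c\<^sub>1\<^sup>3\<close>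
  (\<open>log_inverse_coeffs_of_Schwarz_function\<close>). Conversely every Schwarz function belongs to some
  \<open>f\<close>, because the differential equation can be integrated
  (\<open>Janowski_function_with_Schwarz_function\<close>). The theorem is therefore a sharp estimate of three
  functionals on Schwarz functions.

  The inverse in \<open>\<Gamma>\<^sub>n\<close> is chosen from all preimages in the disk, so it has to be known that small
  values are taken only near the origin. This is a starlikeness argument: \<open>q = f / (z f')\<close> satisfies
  \<open>z q' + q p = 1\<close> with \<open>Re p > 0\<close>, which forces \<open>Re q > 0\<close>, and then \<open>\<bar>f\<bar>\<close> grows along radii.

  The Schur algorithm parametrizes the coefficients of \<open>\<omega>\<close>: \<open>c\<^sub>1 = x\<close>,
  \<open>c\<^sub>2 = (1 - \<bar>x\<bar>\<^sup>2) y\<close>, \<open>c\<^sub>3 = (1 - \<bar>x\<bar>\<^sup>2) ((1 - \<bar>y\<bar>\<^sup>2) w - cnj x y\<^sup>2)\<close> with \<open>x, y, w\<close> in the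
  closed disk. The first two estimates are then immediate. For the third one, a rotation makes \<open>x = r\<close>
  real and nonnegative. In the cosine of the argument of \<open>y\<close> the squared modulus is a quadratic
  polynomial, whose maximum on \<open>[-1, 1]\<close> is attained at the endpoint \<open>-1\<close> or is at most the value at its
  vertex. With \<open>\<rho> = \<bar>y\<bar>\<close> this leaves the functions \<open>edge_value\<close> and \<open>vertex_value\<close> of
  \<open>(r, \<rho>)\<close>. The edge values never exceed the larger of \<open>1\<close> and
  \<open>M = 2/3 (\<bar>\<mu>\<bar> + 1) s\<close>, where \<open>s\<^sup>2 = (\<bar>\<mu>\<bar> + 1) / (3 (\<bar>\<mu>\<bar> + 1 + \<nu>))\<close>. The vertex values increase with
  \<open>\<rho>\<close>, up to the point where they meet an edge value or up to \<open>\<rho> = 1\<close>, where a cubic in \<open>r\<^sup>2\<close>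
  remains. That cubic decreases from a point where it equals an edge value, or, on \<open>D6\<close>, increases up to
  \<open>\<nu>\<^sup>2\<close> at \<open>r = 1\<close>.

  Throughout, \<open>\<nu> = \<mu>\<^sup>2 / 4 - (A - B)\<^sup>2 / 16\<close>, hence \<open>\<mu>\<^sup>2 / 4 - 1 / 4 \<le> \<nu> \<le> \<mu>\<^sup>2 / 4\<close>. Equality holds for \<open>\<omega> = z\<close>, \<open>z\<^sup>2\<close>, \<open>z\<^sup>3\<close>, and, when
  the bound is \<open>M\<close>, for a Blaschke product of degree two with \<open>c\<^sub>1 = s\<close>.
\<close>

section \<open>Taylor coefficients of Schwarz functions\<close>

lemma has_fps_expansion_eqI:
  fixes f g :: "complex \<Rightarrow> complex"
  assumes "f has_fps_expansion F" "g has_fps_expansion G" "0 < e"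
    and "\<And>z. z \<in> ball 0 e \<Longrightarrow> f z = g z"
  shows "F = G"
proof -
  have "eventually (\<lambda>z. z \<in> ball 0 e) (nhds (0 :: complex))"
    using assms(3) by (intro eventually_nhds_in_open) auto
  then have "eventually (\<lambda>z. f z = g z) (nhds 0)"
    by eventually_elim (rule assms(4))
  then have "f has_fps_expansion G"
    using assms(2) has_fps_expansion_cong[of f g G G] by simp
  with assms(1) show ?thesis by (rule fps_expansion_unique_complex)
qed

lemma has_fps_expansion_holomorphic_ball:
  assumes "f holomorphic_on ball 0 e" "0 < e"
  shows "f has_fps_expansion fps_expansion f 0"
  using assms by (intro has_fps_expansion_fps_expansion[OF open_ball]) auto

lemma Schwarz_quotient:
  assumes q: "q holomorphic_on ball 0 1" "q 0 = 0" and lt: "\<And>z. z \<in> ball 0 1 \<Longrightarrow> cmod (q z) < 1"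
  obtains h where "h holomorphic_on ball 0 1" "\<And>z. z \<in> ball 0 1 \<Longrightarrow> cmod (h z) \<le> 1"
    "\<And>z. z \<in> ball 0 1 \<Longrightarrow> q z = z * h z"
proof -
  obtain h where h: "h holomorphic_on ball 0 1" "\<And>z. norm z < 1 \<Longrightarrow> q z = z * h z" "deriv q 0 = h 0"
    using Schwarz3[OF q] by metis
  have "cmod (h z) \<le> 1" if "z \<in> ball 0 1" for z
  proof (cases "z = 0")
    case True
    then show ?thesis using Schwarz_Lemma(2)[OF q, of 0] lt h(3) by auto
  next
    case False
    have "cmod (q z) \<le> cmod z" using Schwarz_Lemma(1)[OF q, of z] lt that by auto
    then have "cmod z * cmod (h z) \<le> cmod z * 1" using h(2)[of z] that by (simp add: norm_mult)
    then show ?thesis using False by (simp add: mult_le_cancel_left)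
  qed
  with h show thesis using that by auto
qed

text \<open>
  One step of the Schur algorithm: \<open>g\<close> followed by the disk automorphism that sends \<open>g 0\<close> to \<open>0\<close> is
  divisible by \<open>z\<close>, and the Schwarz lemma bounds the quotient. The relation is cleared of denominators, so that it also covers the
  degenerate case of a constant \<open>g\<close> of modulus one (take \<open>h = 0\<close>) and translates directly into an
  identity of power series.
\<close>

lemma Schur_step:
  assumes g: "g holomorphic_on ball 0 1" and le: "\<And>z. z \<in> ball 0 1 \<Longrightarrow> cmod (g z) \<le> 1"
  obtains h where "h holomorphic_on ball 0 1" "\<And>z. z \<in> ball 0 1 \<Longrightarrow> cmod (h z) \<le> 1"
    "\<And>z. z \<in> ball 0 1 \<Longrightarrow> g z * (1 + cnj (g 0) * (z * h z)) = g 0 + z * h z"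
proof (cases "g constant_on ball 0 1")
  case True
  then obtain c where "\<And>z. z \<in> ball 0 1 \<Longrightarrow> g z = c" unfolding constant_on_def by auto
  then show thesis using that[of "\<lambda>_. 0"] by auto
next
  case False
  have lt: "cmod (g z) < 1" if z: "z \<in> ball 0 1" for z
  proof (rule ccontr)
    assume "\<not> cmod (g z) < 1"
    then have 1: "cmod (g z) = 1" using le[OF z] by simp
    have "g constant_on ball 0 1"
      by (rule maximum_modulus_principle[OF g, where U = "ball 0 1" and \<xi> = z]) (use z 1 le in auto)
    with False show False by simp
  qed
  define q where "q z = Moebius_function 0 (g 0) (g z)" for z
  have ne: "1 - cnj (g 0) * g z \<noteq> 0" if "z \<in> ball 0 1" for z
  proof
    assume "1 - cnj (g 0) * g z = 0"
    then have "cmod (cnj (g 0) * g z) = 1" by simp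
    moreover have "cmod (cnj (g 0)) * cmod (g z) < 1 * 1"
      using lt[of 0] lt[OF that] by (intro mult_strict_mono') auto
    ultimately show False by (simp add: norm_mult)
  qed
  have q: "q holomorphic_on ball 0 1"
    unfolding q_def Moebius_function_def using ne by (intro holomorphic_intros g) auto
  have "cmod (q z) < 1" if "z \<in> ball 0 1" for z
    unfolding q_def using lt[of 0] lt[OF that] by (intro Moebius_function_norm_lt_1) auto
  then obtain h where h: "h holomorphic_on ball 0 1" "\<And>z. z \<in> ball 0 1 \<Longrightarrow> cmod (h z) \<le> 1"
      "\<And>z. z \<in> ball 0 1 \<Longrightarrow> q z = z * h z"
    using Schwarz_quotient[OF q] by (auto simp: q_def Moebius_function_def)
  have "g z * (1 + cnj (g 0) * (z * h z)) = g 0 + z * h z" if z: "z \<in> ball 0 1" for z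
  proof -
    have "g z - g 0 = z * h z * (1 - cnj (g 0) * g z)"
      using ne[OF z] h(3)[OF z] by (simp add: q_def Moebius_function_def field_simps)
    then show ?thesis by (simp add: algebra_simps)
  qed
  then show thesis using that h by blast
qed

lemma Schur_step_coeffs:
  fixes G H :: "complex fps"
  assumes "G * (1 + fps_const (cnj x) * (fps_X * H)) = fps_const x + fps_X * H"
  shows "fps_nth G 0 = x"
    and "fps_nth G 1 = of_real (1 - (cmod x)\<^sup>2) * fps_nth H 0"
    and "fps_nth G 2 = of_real (1 - (cmod x)\<^sup>2) * (fps_nth H 1 - cnj x * (fps_nth H 0)\<^sup>2)"
proof -
  have nx: "of_real (1 - (cmod x)\<^sup>2) = 1 - x * cnj x" by (simp only: of_real_diff complex_norm_square of_real_1)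
  have G: "G = fps_const x + fps_X * H - fps_const (cnj x) * (fps_X * (G * H))"
    using assms by (simp add: algebra_simps)
  have n: "fps_nth G n = fps_nth (fps_const x + fps_X * H) n - cnj x * fps_nth (fps_X * (G * H)) n" for n
    using arg_cong[OF G, of "\<lambda>P. fps_nth P n"] by simp
  show 0: "fps_nth G 0 = x" using n[of 0] by simp
  show 1: "fps_nth G 1 = of_real (1 - (cmod x)\<^sup>2) * fps_nth H 0"
    using n[of 1] 0 unfolding nx by (simp add: algebra_simps)
  have "fps_nth G 2 = fps_nth H 1 - cnj x * (fps_nth G 0 * fps_nth H 1 + fps_nth G 1 * fps_nth H 0)"
    using n[of 2] by (simp add: fps_mult_nth_1 numeral_2_eq_2)
  then show "fps_nth G 2 = of_real (1 - (cmod x)\<^sup>2) * (fps_nth H 1 - cnj x * (fps_nth H 0)\<^sup>2)"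
    unfolding 0 1 nx by (simp add: algebra_simps power2_eq_square)
qed

text \<open>
  Three Schur steps: \<open>x\<close>, \<open>y\<close>, \<open>w\<close> are the values at \<open>0\<close> of the successive Schur transforms of \<open>\<omega> / z\<close>.
\<close>

lemma Schwarz_function_coeffs:
  assumes \<omega>: "\<omega> holomorphic_on ball 0 1" "\<omega> 0 = 0" "\<omega> ` ball 0 1 \<subseteq> ball 0 1"
  obtains x y w where "cmod x \<le> 1" "cmod y \<le> 1" "cmod w \<le> 1"
    "fps_nth (fps_expansion \<omega> 0) 1 = x"
    "fps_nth (fps_expansion \<omega> 0) 2 = of_real (1 - (cmod x)\<^sup>2) * y"
    "fps_nth (fps_expansion \<omega> 0) 3
       = of_real (1 - (cmod x)\<^sup>2) * (of_real (1 - (cmod y)\<^sup>2) * w - cnj x * y\<^sup>2)"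
proof -
  obtain g where g: "g holomorphic_on ball 0 1" "\<And>z. z \<in> ball 0 1 \<Longrightarrow> cmod (g z) \<le> 1"
      "\<And>z. z \<in> ball 0 1 \<Longrightarrow> \<omega> z = z * g z"
  proof (rule Schwarz_quotient[OF \<omega>(1,2)])
    show "cmod (\<omega> z) < 1" if "z \<in> ball 0 1" for z
      using \<omega>(3) that by (auto simp: image_subset_iff)
  qed blast
  obtain h where h: "h holomorphic_on ball 0 1" "\<And>z. z \<in> ball 0 1 \<Longrightarrow> cmod (h z) \<le> 1"
      "\<And>z. z \<in> ball 0 1 \<Longrightarrow> g z * (1 + cnj (g 0) * (z * h z)) = g 0 + z * h z"
    using Schur_step[OF g(1,2)] by metis
  obtain k where k: "k holomorphic_on ball 0 1" "\<And>z. z \<in> ball 0 1 \<Longrightarrow> cmod (k z) \<le> 1"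
      "\<And>z. z \<in> ball 0 1 \<Longrightarrow> h z * (1 + cnj (h 0) * (z * k z)) = h 0 + z * k z"
    using Schur_step[OF h(1,2)] by metis
  note E = has_fps_expansion_holomorphic_ball[OF _ zero_less_one]
  define G H K where "G = fps_expansion g 0" and "H = fps_expansion h 0" and "K = fps_expansion k 0"
  have GHK: "g has_fps_expansion G" "h has_fps_expansion H" "k has_fps_expansion K"
    unfolding G_def H_def K_def using E g h k by auto
  have "fps_expansion \<omega> 0 = fps_X * G"
    by (rule has_fps_expansion_eqI[OF E[OF \<omega>(1)] _ zero_less_one g(3)]) (intro fps_expansion_intros GHK)
  then have W: "fps_nth (fps_expansion \<omega> 0) (Suc n) = fps_nth G n" for n
    by simp
  have step: "U * (1 + fps_const (cnj (u 0)) * (fps_X * V)) = fps_const (u 0) + fps_X * V"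
    if "u has_fps_expansion U" "v has_fps_expansion V"
      "\<And>z. z \<in> ball 0 1 \<Longrightarrow> u z * (1 + cnj (u 0) * (z * v z)) = u 0 + z * v z" for u v :: "complex \<Rightarrow> complex" and U V
  proof -
    have zv: "(\<lambda>z. z * v z) has_fps_expansion fps_X * V"
      by (intro has_fps_expansion_mult has_fps_expansion_fps_X that(2))
    have l: "(\<lambda>z. u z * (1 + cnj (u 0) * (z * v z))) has_fps_expansion
              U * (1 + fps_const (cnj (u 0)) * (fps_X * V))"
      by (intro has_fps_expansion_mult[OF that(1)] has_fps_expansion_add has_fps_expansion_1
            has_fps_expansion_cmult_left zv)
    have "(\<lambda>z. u 0 + z * v z) has_fps_expansion fps_const (u 0) + fps_X * V"
      by (intro has_fps_expansion_add has_fps_expansion_const zv)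
    from has_fps_expansion_eqI[OF l this zero_less_one that(3)] show ?thesis .
  qed
  note G = Schur_step_coeffs[OF step[OF GHK(1,2) h(3)]]
  note H = Schur_step_coeffs[OF step[OF GHK(2,3) k(3)]]
  have K: "fps_nth K 0 = k 0" by (simp add: K_def fps_expansion_def)
  show thesis
    using that[of "g 0" "h 0" "k 0"] g(2)[of 0] h(2)[of 0] k(2)[of 0] W[of 0] W[of 1] W[of 2] G H K
    by (simp add: numeral_2_eq_2 numeral_3_eq_3)
qed

section \<open>Univalence of convex functions near the origin\<close>

text \<open>
  Convexity implies starlikeness, for \<open>q = f / (z f')\<close>. Differentiating \<open>f = z q f'\<close> gives
  \<open>z q' + q p = 1\<close> with \<open>p = 1 + z f'' / f'\<close>. At a point \<open>w\<close> of least modulus with \<open>Re q \<le> 0\<close>, the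
  value \<open>q w\<close> is purely imaginary and the inward derivatives of \<open>Re q\<close> are nonnegative, so
  \<open>w q' w\<close> is real and at most \<open>0\<close>. The imaginary part of the equation and \<open>Re p > 0\<close> give
  \<open>q w = 0\<close>, and the real part then reads \<open>w q' w = 1\<close>.
\<close>

lemma convex_imp_Re_quotient_pos:
  assumes f: "f holomorphic_on ball 0 1" and nz: "\<And>z. z \<in> ball 0 1 \<Longrightarrow> deriv f z \<noteq> 0"
    and q: "q holomorphic_on ball 0 1" and fq: "\<And>z. z \<in> ball 0 1 \<Longrightarrow> f z = z * q z * deriv f z"
    and pos: "\<And>z. z \<in> ball 0 1 \<Longrightarrow> 0 < Re (1 + z * deriv (deriv f) z / deriv f z)"
    and z: "z \<in> ball 0 1"
  shows "0 < Re (q z)"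
proof (rule ccontr)
  assume neg: "\<not> 0 < Re (q z)"
  have f': "deriv f holomorphic_on ball 0 1" by (intro holomorphic_deriv f) auto
  have ode: "w * deriv q w + q w * (1 + w * deriv (deriv f) w / deriv f w) = 1" if w: "w \<in> ball 0 1" for w
  proof -
    have dq: "(q has_field_derivative deriv q w) (at w)"
      and ddf: "(deriv f has_field_derivative deriv (deriv f) w) (at w)"
      and df: "(f has_field_derivative deriv f w) (at w)"
      using holomorphic_derivI[OF q _ w] holomorphic_derivI[OF f' _ w] holomorphic_derivI[OF f _ w] by auto
    have "((\<lambda>w. w * q w * deriv f w) has_field_derivative
            (q w + w * deriv q w) * deriv f w + w * q w * deriv (deriv f) w) (at w)"
      by (auto intro!: derivative_eq_intros dq ddf simp: algebra_simps)
    then have "(f has_field_derivative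
            (q w + w * deriv q w) * deriv f w + w * q w * deriv (deriv f) w) (at w)"
      by (rule has_field_derivative_transform_within_open[OF _ open_ball w]) (simp add: fq)
    then have "deriv f w = (q w + w * deriv q w) * deriv f w + w * q w * deriv (deriv f) w"
      using df by (rule DERIV_unique[symmetric])
    then show ?thesis using nz[OF w] by (simp add: field_simps)
  qed
  have q0: "q 0 = 1" using ode[of 0] by simp
  have qc: "continuous_on (ball 0 1) q" by (rule holomorphic_on_imp_continuous_on[OF q])
  have sub: "cball 0 (cmod z) \<subseteq> ball 0 1" using z by auto
  define K where "K = {w \<in> cball 0 (cmod z). Re (q w) \<le> 0}"
  have "closed K"
    unfolding K_def using continuous_on_subset[OF qc sub]
    by (intro continuous_closed_preimage[of _ "\<lambda>w. Re (q w)" "{..0}", unfolded vimage_def, simplified Int_def, simplified])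
       (auto intro!: continuous_intros)
  then have "compact K"
    unfolding K_def by (metis (no_types, lifting) Collect_mono compact_cball compact_Int_closed inf.absorb_iff2 inf_commute mem_Collect_eq subsetI)
  moreover have "K \<noteq> {}" using neg by (auto simp: K_def)
  ultimately obtain w where w: "w \<in> K" and min: "\<And>v. v \<in> K \<Longrightarrow> cmod w \<le> cmod v"
    using continuous_attains_inf[of K cmod] by (auto intro: continuous_intros)
  have wb: "w \<in> ball 0 1" and Rew: "Re (q w) \<le> 0" using w z by (auto simp: K_def)
  have inner: "0 < Re (q v)" if "cmod v < cmod w" for v
    using min[of v] that w by (force simp: K_def)
  have w0: "w \<noteq> 0" using Rew q0 by auto
  \<comment> \<open>otherwise \<open>Re q\<close> would vanish on the segment from \<open>0\<close> to \<open>w\<close> before \<open>w\<close>\<close>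
  have Rew0: "Re (q w) = 0"
  proof -
    have "continuous_on {0..1} (\<lambda>t. Re (q (of_real t * w)))"
    proof (intro continuous_intros continuous_on_compose2[OF qc])
      have "cmod (of_real t * w) < 1" if "t \<in> {0..1}" for t
      proof -
        have "t * cmod w \<le> 1 * cmod w" using that by (intro mult_right_mono) auto
        then show ?thesis using that wb by (simp add: norm_mult)
      qed
      then show "(\<lambda>t. of_real t * w) ` {0..1} \<subseteq> ball 0 1" by auto
    qed
    then have "\<exists>t\<ge>0. t \<le> 1 \<and> Re (q (of_real t * w)) = 0"
      using q0 Rew by (intro IVT2') auto
    then obtain t where t: "0 \<le> t" "t \<le> 1" "Re (q (of_real t * w)) = 0" by blast
    have "\<not> cmod (of_real t * w) < cmod w" using inner t(3) by fastforce
    then have "t = 1" using t w0 by (auto simp: norm_mult)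
    with t show ?thesis by simp
  qed
  \<comment> \<open>the directions \<open>w \<zeta>\<close> with \<open>Re \<zeta> < 0\<close> point from \<open>w\<close> into the disk of radius \<open>\<bar>w\<bar>\<close>\<close>
  define c where "c = w * deriv q w"
  have dir: "0 \<le> Re (c * \<zeta>)" if \<zeta>: "Re \<zeta> < 0" for \<zeta>
  proof (rule ccontr)
    assume neg: "\<not> 0 \<le> Re (c * \<zeta>)"
    have dq: "(q has_field_derivative deriv q w) (at w)" using holomorphic_derivI[OF q _ wb] by auto
    have "((\<lambda>t. q (w + of_real t * (w * \<zeta>))) has_vector_derivative (w * \<zeta>) * deriv q w) (at 0)"
    proof -
      have "((\<lambda>t. w + of_real t * (w * \<zeta>)) has_vector_derivative (w * \<zeta>)) (at 0)"
        by (auto intro!: derivative_eq_intros simp: has_vector_derivative_def scaleR_conv_of_real)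
      from field_vector_diff_chain_at[OF this, of q "deriv q w"] dq show ?thesis by (simp add: o_def)
    qed
    then have "((\<lambda>t. Re (q (w + of_real t * (w * \<zeta>)))) has_real_derivative Re (c * \<zeta>)) (at 0)"
      using bounded_linear.has_vector_derivative[OF bounded_linear_Re]
      by (fastforce simp: has_real_derivative_iff_has_vector_derivative c_def mult_ac)
    from DERIV_neg_dec_right[OF this] neg obtain d where d: "d > 0"
      "\<And>h. 0 < h \<Longrightarrow> h < d \<Longrightarrow> Re (q (w + of_real h * (w * \<zeta>))) < Re (q w)" by auto
    have \<zeta>0: "0 < (cmod \<zeta>)\<^sup>2" using \<zeta> by auto
    define h where "h = min (d / 2) (- Re \<zeta> / (cmod \<zeta>)\<^sup>2)"
    have h: "0 < h" "h < d" using d \<zeta> \<zeta>0 by (auto simp: h_def divide_neg_pos)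
    have "h * (cmod \<zeta>)\<^sup>2 \<le> (- Re \<zeta> / (cmod \<zeta>)\<^sup>2) * (cmod \<zeta>)\<^sup>2"
      by (intro mult_right_mono) (auto simp: h_def)
    then have hz: "h * (cmod \<zeta>)\<^sup>2 \<le> - Re \<zeta>" using \<zeta>0 by simp
    have "(cmod (1 + of_real h * \<zeta>))\<^sup>2 = 1 + h * (2 * Re \<zeta> + h * (cmod \<zeta>)\<^sup>2)"
      unfolding cmod_power2 by (simp add: power2_eq_square algebra_simps)
    also have "\<dots> < 1" using h hz \<zeta> by (simp add: mult_pos_neg)
    finally have "cmod (1 + of_real h * \<zeta>) < 1" by (simp add: power_less_one_iff abs_square_less_1)
    then have "cmod w * cmod (1 + of_real h * \<zeta>) < cmod w * 1" using w0 by (intro mult_strict_left_mono) auto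
    then have "cmod (w + of_real h * (w * \<zeta>)) < cmod w"
      by (simp add: algebra_simps flip: norm_mult)
    then have "0 < Re (q (w + of_real h * (w * \<zeta>)))" by (rule inner)
    with d(2)[OF h] Rew0 show False by simp
  qed
  have Rec: "Re c \<le> 0" using dir[of "-1"] by simp
  have Imc: "Im c = 0"
  proof (rule ccontr)
    assume "Im c \<noteq> 0"
    \<comment> \<open>\<open>\<epsilon>\<close> is so small that in one of the directions \<open>-\<epsilon> \<plusminus> i\<close> the imaginary part of \<open>c\<close> outweighs
       the real part\<close>
    define \<epsilon> where "\<epsilon> = \<bar>Im c\<bar> / (2 * (1 + \<bar>Re c\<bar>))"
    have \<epsilon>: "0 < \<epsilon>" using \<open>Im c \<noteq> 0\<close> by (simp add: \<epsilon>_def)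
    have "2 * \<epsilon> * (1 + \<bar>Re c\<bar>) = \<bar>Im c\<bar>" by (simp add: \<epsilon>_def field_simps)
    moreover have "0 \<le> - \<epsilon> * Re c - Im c" using dir[of "Complex (-\<epsilon>) 1"] \<epsilon> by (simp add: algebra_simps)
    moreover have "0 \<le> - \<epsilon> * Re c + Im c" using dir[of "Complex (-\<epsilon>) (-1)"] \<epsilon> by (simp add: algebra_simps)
    ultimately have "2 * \<epsilon> * (1 + \<bar>Re c\<bar>) \<le> \<epsilon> * \<bar>Re c\<bar>"
      using Rec by (simp add: abs_if split: if_splits)
    then have "\<epsilon> * (2 + \<bar>Re c\<bar>) \<le> 0" by (simp add: algebra_simps)
    moreover have "0 < \<epsilon> * (2 + \<bar>Re c\<bar>)" using \<epsilon> by (intro mult_pos_pos) auto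
    ultimately show False by linarith
  qed
  define p where "p = 1 + w * deriv (deriv f) w / deriv f w"
  have "c + q w * p = 1" using ode[OF wb] by (simp add: c_def p_def)
  then have re: "Re c + Re (q w * p) = 1" and im: "Im c + Im (q w * p) = 0"
    by (metis plus_complex.sel(1) one_complex.sel(1), metis plus_complex.sel(2) one_complex.sel(2))
  have "0 < Re p" using pos[OF wb] by (simp add: p_def)
  then have "Im (q w) = 0" using im Imc Rew0 by simp
  then have "Re c = 1" using re Rew0 by simp
  with Rec show False by simp
qed

text \<open>
  Along a radius the derivative of \<open>\<bar>f\<bar>\<^sup>2\<close> has the sign of \<open>Re (z f' cnj f)\<close>, that is, of \<open>Re q\<close>.
\<close>

lemma norm_radially_increasing:
  assumes f: "f holomorphic_on ball 0 1"
    and fq: "\<And>z. z \<in> ball 0 1 \<Longrightarrow> f z = z * q z * deriv f z"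
    and pos: "\<And>z. z \<in> ball 0 1 \<Longrightarrow> 0 < Re (q z)"
    and z: "z \<in> ball 0 1" and t: "0 < t" "t \<le> 1"
  shows "cmod (f (of_real t * z)) \<le> cmod (f z)"
proof -
  define \<psi> where "\<psi> s = (Re (f (of_real s * z)))\<^sup>2 + (Im (f (of_real s * z)))\<^sup>2" for s
  have "\<psi> t \<le> \<psi> 1"
  proof (rule DERIV_nonneg_imp_nondecreasing[OF t(2)])
    fix s assume s: "t \<le> s" "s \<le> 1"
    define v where "v = of_real s * z"
    have s0: "0 < s" using s t by simp
    have "s * cmod z \<le> 1 * cmod z" using s by (intro mult_right_mono) auto
    then have v: "v \<in> ball 0 1" using z s0 by (simp add: v_def norm_mult)
    have df: "(f has_field_derivative deriv f v) (at v)" using holomorphic_derivI[OF f _ v] by auto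
    have "((\<lambda>t. of_real t * z) has_vector_derivative z) (at s)"
      by (auto intro!: derivative_eq_intros simp: has_vector_derivative_def scaleR_conv_of_real)
    from field_vector_diff_chain_at[OF this, of f "deriv f v"] df
    have vd: "((\<lambda>t. f (of_real t * z)) has_vector_derivative (z * deriv f v)) (at s)"
      by (simp add: o_def v_def)
    have dRe: "((\<lambda>t. Re (f (of_real t * z))) has_real_derivative Re (z * deriv f v)) (at s)"
      using bounded_linear.has_vector_derivative[OF bounded_linear_Re vd]
      by (simp add: has_real_derivative_iff_has_vector_derivative)
    have dIm: "((\<lambda>t. Im (f (of_real t * z))) has_real_derivative Im (z * deriv f v)) (at s)"
      using bounded_linear.has_vector_derivative[OF bounded_linear_Im vd]
      by (simp add: has_real_derivative_iff_has_vector_derivative)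
    define u where "u = z * deriv f v"
    have "(\<psi> has_real_derivative 2 * (Re (f v) * Re u + Im (f v) * Im u)) (at s)"
      unfolding \<psi>_def by (rule derivative_eq_intros dRe dIm refl)+ (simp add: u_def v_def)
    moreover have "f v = of_real s * (q v * u)" using fq[OF v] by (simp add: u_def v_def)
    then have "Re (f v) * Re u + Im (f v) * Im u = s * (Re (q v) * (cmod u)\<^sup>2)"
      unfolding cmod_power2 by (simp add: power2_eq_square algebra_simps)
    then have "0 \<le> Re (f v) * Re u + Im (f v) * Im u" using s0 pos[OF v] by simp
    ultimately show "\<exists>y. (\<psi> has_real_derivative y) (at s) \<and> 0 \<le> y" by force
  qed
  then have "(cmod (f (of_real t * z)))\<^sup>2 \<le> (cmod (f z))\<^sup>2" by (simp add: \<psi>_def cmod_power2)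
  then show ?thesis by (rule power2_le_imp_le) simp
qed

text \<open>
  The function \<open>inv_into\<close> picks an arbitrary preimage in the whole disk. Near \<open>0\<close> it agrees with the
  holomorphic local inverse, because \<open>f\<close> is injective on a small disk and, by radial growth, bounded
  away from \<open>0\<close> outside of it.
\<close>

lemma convex_local_inverse:
  assumes f: "f holomorphic_on ball 0 1" "f 0 = 0" and nz: "\<And>z. z \<in> ball 0 1 \<Longrightarrow> deriv f z \<noteq> 0"
    and pos: "\<And>z. z \<in> ball 0 1 \<Longrightarrow> 0 < Re (1 + z * deriv (deriv f) z / deriv f z)"
  obtains g d e where "0 < d" "0 < e" "g holomorphic_on ball 0 d" "g 0 = 0"
    "\<And>w. w \<in> ball 0 d \<Longrightarrow> f (g w) = w" "\<And>w. w \<in> ball 0 d \<Longrightarrow> inv_into (ball 0 1) f w = g w"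
    "\<And>z. z \<in> ball 0 e \<Longrightarrow> f z \<in> ball 0 d \<and> g (f z) = z"
proof -
  obtain h where h: "h holomorphic_on ball 0 1" "\<And>z. norm z < 1 \<Longrightarrow> f z = z * h z"
    using Schwarz3[OF f] by metis
  define q where "q z = h z / deriv f z" for z
  have q: "q holomorphic_on ball 0 1"
    unfolding q_def using nz by (intro holomorphic_intros h holomorphic_deriv f) auto
  have fq: "f z = z * q z * deriv f z" if "z \<in> ball 0 1" for z
    using h(2)[of z] nz[OF that] that by (simp add: q_def)
  have qpos: "0 < Re (q z)" if "z \<in> ball 0 1" for z
    by (rule convex_imp_Re_quotient_pos[OF f(1) nz q fq pos that])
  have f0: "f z \<noteq> 0" if "z \<in> ball 0 1" "z \<noteq> 0" for z
    using fq[OF that(1)] qpos[OF that(1)] nz[OF that(1)] that(2) by auto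
  obtain r where r: "r > 0" "ball 0 r \<subseteq> ball (0 :: complex) 1" "inj_on f (ball 0 r)"
  proof (rule has_complex_derivative_locally_injective[OF f(1) _ open_ball])
    show "(0::complex) \<in> ball 0 1" and "deriv f 0 \<noteq> 0" using nz[of 0] by auto
  qed (rule that)
  have r1: "r \<le> 1"
    using r(1,2) ball_subset_ball_iff[of "0 :: complex" r 0 1] by simp
  have fr: "f holomorphic_on ball 0 r" using f(1) r(2) by (rule holomorphic_on_subset)
  obtain g where g: "g holomorphic_on f ` ball 0 r" "\<And>z. z \<in> ball 0 r \<Longrightarrow> g (f z) = z"
    using holomorphic_has_inverse[OF fr open_ball r(3)] by (metis (no_types))
  have "open (f ` ball 0 r)" using open_mapping_thm3[OF fr open_ball r(3)] .
  moreover have "0 \<in> f ` ball 0 r" using f(2) r(1) by force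
  ultimately obtain d1 where d1: "d1 > 0" "ball 0 d1 \<subseteq> f ` ball 0 r"
    by (metis open_contains_ball)
  have "continuous_on (sphere 0 (r/2)) (\<lambda>z. cmod (f z))"
    using r r1 by (intro continuous_intros holomorphic_on_imp_continuous_on holomorphic_on_subset[OF f(1)]) auto
  moreover have "sphere 0 (r/2) \<noteq> ({} :: complex set)" using r by simp
  ultimately obtain z0 where z0: "z0 \<in> sphere 0 (r/2)"
      and min: "\<And>z. z \<in> sphere 0 (r/2) \<Longrightarrow> cmod (f z0) \<le> cmod (f z)"
    using continuous_attains_inf[OF compact_sphere, of 0 "r/2" "\<lambda>z. cmod (f z)"] by blast
  have d2: "0 < cmod (f z0)" using f0[of z0] z0 r r1 by auto
  have far: "cmod (f z0) \<le> cmod (f z)" if "z \<in> ball 0 1" "r / 2 \<le> cmod z" for z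
  proof -
    have z: "0 < cmod z" using that r by linarith
    define t where "t = r / 2 / cmod z"
    have t: "0 < t" "t \<le> 1" using z that r by (auto simp: t_def)
    have "t * cmod z = r / 2" using z by (simp add: t_def)
    then have "of_real t * z \<in> sphere 0 (r/2)" using t by (simp add: norm_mult del: of_real_divide)
    then have "cmod (f z0) \<le> cmod (f (of_real t * z))" by (rule min)
    also have "\<dots> \<le> cmod (f z)" by (rule norm_radially_increasing[OF f(1) fq qpos that(1) t])
    finally show ?thesis .
  qed
  define d where "d = min d1 (cmod (f z0))"
  have d: "0 < d" "ball 0 d \<subseteq> f ` ball 0 r" using d1 d2 by (auto simp: d_def)
  have "continuous_on (ball 0 r) f" using fr by (rule holomorphic_on_imp_continuous_on)
  then have "open (ball 0 r \<inter> f -` ball 0 d)" by (intro continuous_open_preimage) auto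
  moreover have "0 \<in> ball 0 r \<inter> f -` ball 0 d" using r d f(2) by auto
  ultimately obtain e where e: "e > 0" "ball 0 e \<subseteq> ball 0 r \<inter> f -` ball 0 d"
    by (metis open_contains_ball)
  show thesis
  proof (rule that[of d e g])
    show "g holomorphic_on ball 0 d" using g(1) d(2) by (rule holomorphic_on_subset)
    show "g 0 = 0" using g(2)[of 0] r f(2) by auto
    show "f (g w) = w" if "w \<in> ball 0 d" for w using g(2) d(2) that by force
    show "inv_into (ball 0 1) f w = g w" if w: "w \<in> ball 0 d" for w
    proof -
      obtain z where z: "z \<in> ball 0 r" "f z = w" using d(2) w by blast
      define v where "v = inv_into (ball 0 1) f w"
      have "w \<in> f ` ball 0 1" using z r(2) by blast
      then have v: "v \<in> ball 0 1" "f v = w" unfolding v_def by (rule inv_into_into, rule f_inv_into_f)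
      have "v \<in> ball 0 r" using far[OF v(1)] v(2) w r(1) by (force simp: d_def)
      then show ?thesis using g(2) v(2) unfolding v_def by metis
    qed
    show "f z \<in> ball 0 d \<and> g (f z) = z" if "z \<in> ball 0 e" for z using e(2) g(2) that by auto
  qed (use d e in auto)
qed

section \<open>Logarithmic inverse coefficients in terms of the Schwarz function\<close>

text \<open>
  The equation determines \<open>M \<circ> F\<close>, and hence \<open>M\<close>, up to the constant term. It is satisfied by the series
  \<open>F\<close> of \<open>f\<close> and the series \<open>M\<close> of \<open>log (f\<inverse>(w) / w)\<close>, so that \<open>M\<close> can be computed without the
  coefficients of \<open>f\<inverse>\<close>.
\<close>

lemma Taylor_coeffs_compose:
  fixes M F :: "complex fps"
  assumes F: "fps_nth F 0 = 0" "fps_nth F 1 = 1"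
    and eq: "fps_X * (fps_deriv (fps_compose M F) * F + fps_deriv F) = F"
  defines "a \<equiv> fps_nth F"
  shows "fps_nth M 1 = - a 2"
    and "fps_nth M 2 = 3 / 2 * (a 2)\<^sup>2 - a 3"
    and "fps_nth M 3 = - a 4 + 4 * a 2 * a 3 - 10 / 3 * a 2 ^ 3"
proof -
  define N where "N = fps_compose M F"
  have F0: "a 0 = 0" "a (Suc 0) = 1" using F by (simp_all add: a_def)
  have nth: "fps_nth (fps_X * (fps_deriv N * F + fps_deriv F)) n = a n" for n
    using eq by (simp add: N_def a_def)
  have N1: "fps_nth N 1 = - a 2"
    using nth[of 2] F0 by (simp add: fps_mult_nth numeral_2_eq_2 a_def[symmetric] eq_neg_iff_add_eq_0 add.commute)
  have N2: "2 * fps_nth N 2 = a 2 ^ 2 - 2 * a 3"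
    using nth[of 3] F0 N1
    by (simp add: fps_mult_nth eval_nat_numeral a_def[symmetric] algebra_simps)
  have N3: "3 * fps_nth N 3 = - 3 * a 4 + 3 * a 2 * a 3 - a 2 ^ 3"
  proof -
    have "fps_nth N 1 * a 3 + 2 * fps_nth N 2 * a 2 + 3 * fps_nth N 3 + 4 * a 4 = a 4"
      using nth[of 4] F0 by (simp add: fps_mult_nth eval_nat_numeral a_def[symmetric] algebra_simps)
    then show ?thesis unfolding N1 N2 by (simp add: algebra_simps power2_eq_square power3_eq_cube eq_neg_iff_add_eq_0)
  qed
  have F2: "fps_nth (F * F) 2 = 1" "fps_nth (F * F) 3 = 2 * a 2" "fps_nth (F * (F * F)) 3 = 1"
    using F0 by (simp_all add: fps_mult_nth eval_nat_numeral a_def[symmetric])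
  have M1: "fps_nth N 1 = fps_nth M 1"
    using F0 by (simp add: N_def fps_compose_nth a_def[symmetric])
  have M2: "fps_nth N 2 = fps_nth M 1 * a 2 + fps_nth M 2"
    using F2 by (simp add: N_def fps_compose_nth eval_nat_numeral a_def[symmetric])
  have M3: "fps_nth N 3 = fps_nth M 1 * a 3 + fps_nth M 2 * (2 * a 2) + fps_nth M 3"
    using F2 by (simp add: N_def fps_compose_nth eval_nat_numeral a_def[symmetric])
  show 1: "fps_nth M 1 = - a 2" using M1 N1 by simp
  show 2: "fps_nth M 2 = 3 / 2 * (a 2)\<^sup>2 - a 3"
    using N2 unfolding M2 1 by (simp add: field_simps power2_eq_square)
  show "fps_nth M 3 = - a 4 + 4 * a 2 * a 3 - 10 / 3 * a 2 ^ 3"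
  proof -
    have h: "6 * fps_nth M 3 = - 6 * a 4 + 24 * (a 2 * a 3) - 20 * a 2 ^ 3"
      using N3 unfolding M3 1 2 by (simp add: field_simps power2_eq_square power3_eq_cube)
    have "fps_nth M 3 = (6 * fps_nth M 3) / 6" by simp
    then show ?thesis unfolding h by (simp add: add_divide_distrib diff_divide_distrib)
  qed
qed

text \<open>
  With \<open>L = log (f\<inverse>(w) / w)\<close> one has \<open>exp (L (f z)) f z = z\<close> near \<open>0\<close>. Differentiating and
  multiplying by \<open>f\<close> removes the exponential, which leaves a polynomial relation between the two series.
\<close>

lemma log_inverse_expansion:
  assumes f: "f holomorphic_on ball 0 1" "f 0 = 0" "deriv f 0 = 1"
    and nz: "\<And>z. z \<in> ball 0 1 \<Longrightarrow> deriv f z \<noteq> 0"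
    and pos: "\<And>z. z \<in> ball 0 1 \<Longrightarrow> 0 < Re (1 + z * deriv (deriv f) z / deriv f z)"
  defines "F \<equiv> fps_expansion f 0" and "L \<equiv> fps_expansion (log_inverse f) 0"
  shows "fps_X * (fps_deriv (fps_compose L F) * F + fps_deriv F) = F"
proof -
  obtain g d e where de: "0 < d" "0 < e" and g: "g holomorphic_on ball 0 d" "g 0 = 0"
    and fg: "\<And>w. w \<in> ball 0 d \<Longrightarrow> f (g w) = w"
    and inv: "\<And>w. w \<in> ball 0 d \<Longrightarrow> inv_into (ball 0 1) f w = g w"
    and gf: "\<And>z. z \<in> ball 0 e \<Longrightarrow> f z \<in> ball 0 d \<and> g (f z) = z"
    by (rule convex_local_inverse[OF f(1,2) nz pos]) blast+
  obtain k where k: "k holomorphic_on ball 0 d" "\<And>w. norm w < d \<Longrightarrow> g w = w * k w" "deriv g 0 = k 0"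
    using Schwarz3[OF g] by metis
  \<comment> \<open>the removable singularity of \<open>f\<inverse>(w) / w\<close> has value \<open>1\<close>, where the principal logarithm is
     holomorphic and vanishes\<close>
  have k0: "k 0 = 1"
  proof -
    have dg: "(g has_field_derivative k 0) (at 0)"
      using holomorphic_derivI[OF g(1) open_ball, of 0] de k(3) by simp
    have "(f has_field_derivative 1) (at (g 0))"
      using holomorphic_derivI[OF f(1) open_ball, of 0] f(3) g(2) by simp
    from DERIV_chain2[OF this dg] have "((\<lambda>w. f (g w)) has_field_derivative k 0) (at 0)" by simp
    then have "((\<lambda>w. w) has_field_derivative k 0) (at 0)"
      by (rule has_field_derivative_transform_within_open[OF _ open_ball, of _ _ _ 0 d]) (use de fg in auto)
    then show ?thesis using DERIV_ident DERIV_unique by blast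
  qed
  have Lk: "log_inverse f w = Ln (k w)" if "w \<in> ball 0 d" for w
    using that inv[OF that] k(2)[of w] k0 by (auto simp: log_inverse_def)
  have "continuous_on (ball 0 d) k" using k(1) by (rule holomorphic_on_imp_continuous_on)
  then have "open (ball 0 d \<inter> k -` {z. 0 < Re z})"
    by (intro continuous_open_preimage open_halfspace_Re_gt) auto
  moreover have "0 \<in> ball 0 d \<inter> k -` {z. 0 < Re z}" using de k0 by simp
  ultimately obtain c where c: "c > 0" "ball 0 c \<subseteq> ball 0 d \<inter> k -` {z. 0 < Re z}"
    by (metis open_contains_ball)
  have "(\<lambda>w. Ln (k w)) holomorphic_on ball 0 c"
    using c(2) by (intro holomorphic_intros holomorphic_on_subset[OF k(1)])
      (auto simp: complex_nonpos_Reals_iff subset_iff)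
  moreover have cd: "w \<in> ball 0 d" if "w \<in> ball 0 c" for w :: complex using c(2) that by auto
  ultimately have "log_inverse f holomorphic_on ball 0 c"
    by (subst holomorphic_cong[OF refl, of _ _ "\<lambda>w. Ln (k w)"]) (auto simp: Lk)
  then have L: "log_inverse f has_fps_expansion L"
    unfolding L_def using c(1) by (rule has_fps_expansion_holomorphic_ball)
  have F: "f has_fps_expansion F"
    unfolding F_def using f(1) by (rule has_fps_expansion_holomorphic_ball) simp
  have F0: "fps_nth F 0 = 0" using f(2) by (simp add: F_def fps_expansion_def)
  have N: "(log_inverse f \<circ> f) has_fps_expansion fps_compose L F"
    by (rule has_fps_expansion_compose[OF L F F0])
  have L0: "fps_nth (fps_compose L F) 0 = 0"
    by (simp add: L_def fps_expansion_def log_inverse_def)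
  have E: "(exp \<circ> (log_inverse f \<circ> f)) has_fps_expansion fps_compose (fps_exp 1) (fps_compose L F)"
    by (rule has_fps_expansion_compose[OF has_fps_expansion_exp1 N L0])
  have ex: "exp (log_inverse f (f z)) * f z = z" if z: "z \<in> ball 0 e" for z
  proof (cases "z = 0")
    case False
    have fz: "f z \<in> ball 0 d" "g (f z) = z" using gf[OF z] by auto
    have "f z * k (f z) = z" using k(2)[of "f z"] fz by auto
    then show ?thesis using Lk[OF fz(1)] False by (cases "k (f z) = 0") (auto simp: mult_ac)
  qed (simp add: f(2))
  define P where "P = fps_compose (fps_exp 1) (fps_compose L F)"
  have PF: "P * F = fps_X"
    unfolding P_def
    by (rule has_fps_expansion_eqI[OF has_fps_expansion_mult[OF E F] has_fps_expansion_fps_X de(2)]) (simp add: ex)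
  have "fps_deriv P = P * fps_deriv (fps_compose L F)"
    unfolding P_def by (subst fps_compose_deriv[OF L0]) simp
  then have "fps_deriv (P * F) = P * (fps_deriv (fps_compose L F) * F + fps_deriv F)"
    by (simp add: algebra_simps)
  then have "P * (fps_deriv (fps_compose L F) * F + fps_deriv F) = 1"
    unfolding PF by simp
  then have "F * (P * (fps_deriv (fps_compose L F) * F + fps_deriv F)) = F" by simp
  then show ?thesis unfolding PF[symmetric] by (simp add: mult_ac)
qed

text \<open>
  The numerator of the real part is affine in \<open>Re w\<close>, with the positive values
  \<open>(1 \<plusminus> A \<rho>) (1 \<plusminus> B \<rho>)\<close> at the endpoints \<open>\<plusminus> \<rho> = \<plusminus> \<bar>w\<bar>\<close>.
\<close>

lemma Janowski_ratio_Re_pos: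
  fixes A B :: real
  assumes "\<bar>A\<bar> \<le> 1" "\<bar>B\<bar> \<le> 1" "cmod w < 1"
  shows "1 + of_real B * w \<noteq> 0" and "0 < Re ((1 + of_real A * w) / (1 + of_real B * w))"
proof -
  have lt: "\<bar>C\<bar> * cmod w < 1" if "\<bar>C\<bar> \<le> 1" for C
    using mult_right_mono[OF that norm_ge_zero[of w]] assms(3) by simp
  show nz: "1 + of_real B * w \<noteq> 0"
  proof
    assume "1 + of_real B * w = 0"
    then have "cmod (of_real B * w) = 1" by (simp add: add_eq_0_iff)
    with lt[OF assms(2)] show False by (simp add: norm_mult)
  qed
  define \<rho> where "\<rho> = cmod w"
  have x: "\<bar>Re w\<bar> \<le> \<rho>" by (simp add: \<rho>_def abs_Re_le_cmod)
  have pos: "0 < (1 - A * \<rho>) * (1 - B * \<rho>)" "0 < (1 + A * \<rho>) * (1 + B * \<rho>)"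
  proof -
    have "\<bar>A * \<rho>\<bar> < 1" "\<bar>B * \<rho>\<bar> < 1"
      using lt[OF assms(1)] lt[OF assms(2)] by (auto simp: \<rho>_def abs_mult)
    then show "0 < (1 - A * \<rho>) * (1 - B * \<rho>)" "0 < (1 + A * \<rho>) * (1 + B * \<rho>)"
      by (auto intro!: mult_pos_pos simp: abs_less_iff)
  qed
  have "\<bar>(A + B) * Re w\<bar> \<le> \<bar>A + B\<bar> * \<rho>" using x by (simp add: abs_mult mult_left_mono)
  then have 1: "0 < 1 + (A + B) * Re w + A * B * \<rho>\<^sup>2"
    using pos by (cases "0 \<le> A + B") (auto simp: algebra_simps power2_eq_square abs_le_iff)
  have "Re ((1 + of_real A * w) / (1 + of_real B * w))
      = (1 + (A + B) * Re w + A * B * \<rho>\<^sup>2) / (cmod (1 + of_real B * w))\<^sup>2"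
    unfolding \<rho>_def cmod_power2 by (simp add: Re_divide power2_eq_square algebra_simps)
  also have "\<dots> > 0" using 1 nz by simp
  finally show "0 < Re ((1 + of_real A * w) / (1 + of_real B * w))" .
qed

text \<open>
  Compare coefficients in \<open>z f'' (1 + B \<omega>) = (A - B) \<omega> f'\<close> up to order three and insert the result into
  the formulas for the \<open>\<Gamma>\<^sub>n\<close>.
\<close>

lemma log_inverse_coeffs_of_Schwarz_function:
  fixes A B :: real
  assumes A: "\<bar>A\<bar> \<le> 1" and B: "\<bar>B\<bar> \<le> 1" and f: "f \<in> normalized_class"
    and nz: "\<And>z. z \<in> ball 0 1 \<Longrightarrow> deriv f z \<noteq> 0"
    and \<omega>: "\<omega> holomorphic_on ball 0 1" "\<omega> 0 = 0" "\<omega> ` ball 0 1 \<subseteq> ball 0 1"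
    and eq: "\<And>z. z \<in> ball 0 1 \<Longrightarrow> 1 + z * deriv (deriv f) z / deriv f z
               = (1 + of_real A * \<omega> z) / (1 + of_real B * \<omega> z)"
  defines "c \<equiv> fps_nth (fps_expansion \<omega> 0)"
  shows "log_inverse_coeff f 1 = of_real (- (A - B) / 4) * c 1"
    and "log_inverse_coeff f 2 = of_real (- (A - B) / 12) * (c 2 - of_real ((5 * A - B) / 4) * (c 1)\<^sup>2)"
    and "log_inverse_coeff f 3 = of_real (- (A - B) / 24) *
           (c 3 + of_real ((B - 5 * A) / 2) * c 1 * c 2 + of_real ((3 * A\<^sup>2 - A * B) / 2) * c 1 ^ 3)"
proof -
  have f1: "f holomorphic_on ball 0 1" "f 0 = 0" "deriv f 0 = 1" using f by (auto simp: normalized_class_def)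
  have \<omega>1: "cmod (\<omega> z) < 1" if "z \<in> ball 0 1" for z using \<omega>(3) that by (auto simp: image_subset_iff)
  define F W L a where "F = fps_expansion f 0" and "W = fps_expansion \<omega> 0"
    and "L = fps_expansion (log_inverse f) 0" and "a = fps_nth F"
  have F: "f has_fps_expansion F" and W: "\<omega> has_fps_expansion W"
    unfolding F_def W_def using f1(1) \<omega>(1) by (auto intro: has_fps_expansion_holomorphic_ball)
  have a01: "a 0 = 0" "a (Suc 0) = 1" using f1 by (auto simp: a_def F_def fps_expansion_def)
  have c0: "c 0 = 0" using \<omega>(2) by (simp add: c_def fps_expansion_def)
  have pos: "0 < Re (1 + z * deriv (deriv f) z / deriv f z)" if "z \<in> ball 0 1" for z
    unfolding eq[OF that] by (rule Janowski_ratio_Re_pos(2)[OF A B \<omega>1[OF that]])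
  have "fps_X * (fps_deriv (fps_compose L F) * F + fps_deriv F) = F"
    unfolding L_def F_def by (rule log_inverse_expansion[OF f1 nz pos])
  note L = Taylor_coeffs_compose[OF _ _ this]
  have F01: "fps_nth F 0 = 0" "fps_nth F 1 = 1" using a01 by (simp_all add: a_def)
  note L = L[OF F01, folded a_def]
  define D :: complex where "D = of_real (A - B)"
  define b :: complex where "b = of_real B"
  have ode: "z * deriv (deriv f) z * (1 + b * \<omega> z) = D * (\<omega> z * deriv f z)" if z: "z \<in> ball 0 1" for z
  proof -
    have n: "1 + b * \<omega> z \<noteq> 0"
      unfolding b_def by (rule Janowski_ratio_Re_pos(1)[OF A B \<omega>1[OF z]])
    have "z * deriv (deriv f) z / deriv f z = (1 + of_real A * \<omega> z) / (1 + b * \<omega> z) - 1"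
      using eq[OF z] by (simp add: b_def algebra_simps)
    also have "\<dots> = D * \<omega> z / (1 + b * \<omega> z)"
      using n by (simp add: D_def b_def field_simps)
    finally show ?thesis using n nz[OF z] by (simp add: field_simps)
  qed
  have l: "(\<lambda>z. z * deriv (deriv f) z * (1 + b * \<omega> z)) has_fps_expansion
      fps_X * fps_deriv (fps_deriv F) * (1 + fps_const b * W)"
    by (intro has_fps_expansion_mult has_fps_expansion_add has_fps_expansion_cmult_left
        has_fps_expansion_1 has_fps_expansion_fps_X has_fps_expansion_deriv F W)
  have r: "(\<lambda>z. D * (\<omega> z * deriv f z)) has_fps_expansion fps_const D * (W * fps_deriv F)"
    by (intro has_fps_expansion_mult has_fps_expansion_cmult_left has_fps_expansion_deriv F W)
  have "fps_X * fps_deriv (fps_deriv F) * (1 + fps_const b * W) = fps_const D * (W * fps_deriv F)"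
    by (rule has_fps_expansion_eqI[OF l r zero_less_one ode])
  then have "fps_X * (fps_deriv (fps_deriv F) + fps_const b * (fps_deriv (fps_deriv F) * W)) = fps_const D * (W * fps_deriv F)"
    by (simp add: algebra_simps)
  then have nth: "fps_nth (fps_X * (fps_deriv (fps_deriv F) + fps_const b * (fps_deriv (fps_deriv F) * W))) n
      = fps_nth (fps_const D * (W * fps_deriv F)) n" for n
    by (rule arg_cong)
  have cW: "fps_nth W n = c n" for n by (simp add: W_def c_def)
  note nat_simps = fps_mult_nth eval_nat_numeral a_def[symmetric] cW
  have e1: "2 * a 2 = D * c 1"
    using nth[of 1] a01 c0 by (simp add: nat_simps)
  have e2: "6 * a 3 + b * (2 * a 2 * c 1) = D * (c 2 + c 1 * (2 * a 2))"
    using nth[of 2] a01 c0 by (simp add: nat_simps algebra_simps)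
  have e3: "12 * a 4 + b * (6 * a 3 * c 1 + 2 * a 2 * c 2) = D * (c 3 + c 2 * (2 * a 2) + c 1 * (3 * a 3))"
    using nth[of 3] a01 c0 by (simp add: nat_simps algebra_simps)
  define c1 c2 c3 where "c1 = c 1" and "c2 = c 2" and "c3 = c 3"
  note e = e1[folded c1_def] e2[folded c1_def c2_def] e3[folded c1_def c2_def c3_def]
  have a2: "a 2 = D * c1 / 2" using e(1) by (simp add: field_simps)
  have a3: "a 3 = D * (c2 + (D - b) * c1\<^sup>2) / 6"
    using e(2) unfolding a2 by (simp add: field_simps power2_eq_square)
  have a4: "a 4 = (D * (c3 + c2 * (2 * a 2) + c1 * (3 * a 3)) - b * (6 * a 3 * c1 + 2 * a 2 * c2)) / 12"
    using e(3) by (simp add: eq_divide_eq eq_diff_eq mult.commute)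
  have AD: "complex_of_real A = D + b" by (simp add: D_def b_def)
  have lic: "log_inverse_coeff f n = fps_nth L n / 2" for n
    by (simp add: log_inverse_coeff_def L_def)
  have D': "complex_of_real (- (A - B) / x) = - D / of_real x" for x by (simp add: D_def)
  show "log_inverse_coeff f 1 = of_real (- (A - B) / 4) * c 1"
    unfolding lic L D' c1_def[symmetric] a2 by (simp add: field_simps)
  show "log_inverse_coeff f 2 = of_real (- (A - B) / 12) * (c 2 - of_real ((5 * A - B) / 4) * (c 1)\<^sup>2)"
    unfolding lic L D' c1_def[symmetric] c2_def[symmetric] a3 a2
    by (simp add: AD b_def[symmetric] field_simps power2_eq_square)
  show "log_inverse_coeff f 3 = of_real (- (A - B) / 24) *
           (c 3 + of_real ((B - 5 * A) / 2) * c 1 * c 2 + of_real ((3 * A\<^sup>2 - A * B) / 2) * c 1 ^ 3)"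
    unfolding lic L D' c1_def[symmetric] c2_def[symmetric] c3_def[symmetric] a4 a3 a2
    by (simp add: AD b_def[symmetric] field_simps power2_eq_square power3_eq_cube)
qed

section \<open>Functions with a prescribed Schwarz function\<close>

lemma holomorphic_primitive_ball:
  assumes "k holomorphic_on ball c r"
  shows "\<exists>K. \<forall>z\<in>ball c r. (K has_field_derivative k z) (at z)"
proof (rule holomorphic_convex_primitive'[OF convex_ball open_ball assms])
  fix K assume K: "\<And>z. z \<in> ball c r \<Longrightarrow> (K has_field_derivative k z) (at z within ball c r)"
  have "(K has_field_derivative k z) (at z)" if "z \<in> ball c r" for z
    using K[OF that] unfolding at_within_open[OF that open_ball] .
  then show ?thesis by blast
qed

text \<open>
  Since \<open>\<omega> = z g\<close>, the equation for \<open>f\<close> reads \<open>f'' / f' = (A - B) g / (1 + B \<omega>)\<close>. The right-hand side is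
  holomorphic on the disk, so two integrations and an exponential solve it.
\<close>

lemma Janowski_function_with_Schwarz_function:
  fixes A B :: real
  assumes A: "\<bar>A\<bar> \<le> 1" and B: "\<bar>B\<bar> \<le> 1"
    and \<omega>: "\<omega> holomorphic_on ball 0 1" "\<omega> 0 = 0" "\<omega> ` ball 0 1 \<subseteq> ball 0 1"
  obtains f where "f \<in> janowski_convex A B"
    "\<And>z. z \<in> ball 0 1 \<Longrightarrow> deriv f z \<noteq> 0"
    "\<And>z. z \<in> ball 0 1 \<Longrightarrow> 1 + z * deriv (deriv f) z / deriv f z
               = (1 + of_real A * \<omega> z) / (1 + of_real B * \<omega> z)"
proof -
  have \<omega>1: "cmod (\<omega> z) < 1" if "z \<in> ball 0 1" for z using \<omega>(3) that by (auto simp: image_subset_iff)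
  have nz: "1 + of_real B * w \<noteq> 0" if "cmod w < 1" for w
    by (rule Janowski_ratio_Re_pos(1)[OF A B that])
  obtain g where g: "g holomorphic_on ball 0 1" "\<And>z. norm z < 1 \<Longrightarrow> \<omega> z = z * g z"
    using Schwarz3[OF \<omega>(1,2)] by metis
  define k where "k z = of_real (A - B) * g z / (1 + of_real B * \<omega> z)" for z
  have "k holomorphic_on ball 0 1"
    unfolding k_def
    by (intro holomorphic_on_divide holomorphic_on_mult holomorphic_on_add holomorphic_on_const
        g(1) \<omega>(1) nz \<omega>1)
  from holomorphic_primitive_ball[OF this] obtain K
    where K: "\<And>z. z \<in> ball 0 1 \<Longrightarrow> (K has_field_derivative k z) (at z)" by blast
  define E where "E z = exp (K z - K 0)" for z
  have dE: "(E has_field_derivative E z * k z) (at z)" if z: "z \<in> ball 0 1" for z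
    unfolding E_def by (auto intro!: derivative_eq_intros K[OF z])
  then have "E holomorphic_on ball 0 1" by (subst holomorphic_on_open) blast+
  from holomorphic_primitive_ball[OF this] obtain f0
    where f0: "\<And>z. z \<in> ball 0 1 \<Longrightarrow> (f0 has_field_derivative E z) (at z)" by blast
  define f where "f z = f0 z - f0 0" for z
  have df: "(f has_field_derivative E z) (at z)" if z: "z \<in> ball 0 1" for z
    unfolding f_def by (auto intro!: derivative_eq_intros f0[OF z])
  have f': "deriv f z = E z" if "z \<in> ball 0 1" for z by (rule DERIV_imp_deriv[OF df[OF that]])
  have f'': "deriv (deriv f) z = E z * k z" if z: "z \<in> ball 0 1" for z
    by (rule DERIV_imp_deriv, rule has_field_derivative_transform_within_open[OF dE[OF z] open_ball z])
       (simp add: f')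
  have f1: "f holomorphic_on ball 0 1" using df by (subst holomorphic_on_open) blast+
  have n: "f \<in> normalized_class"
    using f1 f'[of 0] by (simp add: normalized_class_def f_def E_def)
  have ne: "deriv f z \<noteq> 0" if "z \<in> ball 0 1" for z using f'[OF that] by (simp add: E_def)
  have eq: "1 + z * deriv (deriv f) z / deriv f z = (1 + of_real A * \<omega> z) / (1 + of_real B * \<omega> z)"
    if z: "z \<in> ball 0 1" for z
  proof -
    have "z * deriv (deriv f) z / deriv f z = of_real (A - B) * \<omega> z / (1 + of_real B * \<omega> z)"
      using f'[OF z] f''[OF z] g(2)[of z] z by (simp add: E_def k_def)
    then show ?thesis using nz[OF \<omega>1[OF z]] by (simp add: field_simps)
  qed
  have "(\<lambda>z. 1 + z * deriv (deriv f) z / deriv f z) holomorphic_on ball 0 1"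
    using ne by (intro holomorphic_intros holomorphic_deriv f1) auto
  moreover have "(\<lambda>z. (1 + of_real A * z) / (1 + of_real B * z)) holomorphic_on ball 0 1"
    using nz by (intro holomorphic_intros) auto
  ultimately have "f \<in> janowski_convex A B"
    using n ne eq \<omega> unfolding janowski_convex_def subordinate_def by blast
  then show thesis using that ne eq by blast
qed

text \<open>
  The Schwarz functions for which the Schur algorithm stops after \<open>x = s\<close>, \<open>y = \<sigma> = \<plusminus> 1\<close>. For \<open>s = 1\<close>
  the fraction cancels to \<open>1\<close> and \<open>\<omega>\<close> is the identity.
\<close>

lemma Blaschke_coeffs:
  fixes s \<sigma> :: real
  assumes s: "0 \<le> s" "s \<le> 1" and \<sigma>: "\<sigma> * \<sigma> = 1"
  defines "\<omega> \<equiv> \<lambda>z :: complex. z * ((of_real s + of_real \<sigma> * z) / (1 + of_real s * (of_real \<sigma> * z)))"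
  shows "\<omega> holomorphic_on ball 0 1" "\<omega> 0 = 0" "\<omega> ` ball 0 1 \<subseteq> ball 0 1"
    and "fps_nth (fps_expansion \<omega> 0) 1 = of_real s"
    and "fps_nth (fps_expansion \<omega> 0) 2 = of_real ((1 - s\<^sup>2) * \<sigma>)"
    and "fps_nth (fps_expansion \<omega> 0) 3 = of_real (- (1 - s\<^sup>2) * s)"
proof -
  have \<sigma>1: "\<bar>\<sigma>\<bar> = 1" using \<sigma> by (auto simp: square_eq_1_iff)
  define g where "g z = (of_real s + of_real \<sigma> * z) / (1 + of_real s * (of_real \<sigma> * z))" for z :: complex
  have nz: "1 + of_real s * (of_real \<sigma> * z) \<noteq> 0" if "z \<in> ball 0 1" for z :: complex
  proof -
    have "cmod (of_real \<sigma> * z) < 1" using that \<sigma>1 by (simp add: norm_mult)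
    then show ?thesis using Janowski_ratio_Re_pos(1)[of s s] s by auto
  qed
  have g: "g holomorphic_on ball 0 1"
    unfolding g_def using nz by (intro holomorphic_intros) auto
  have \<omega>g: "\<omega> = (\<lambda>z. z * g z)" by (simp add: \<omega>_def g_def)
  show hol: "\<omega> holomorphic_on ball 0 1"
    unfolding \<omega>g by (intro holomorphic_intros g)
  show "\<omega> 0 = 0" by (simp add: \<omega>_def)
  show "\<omega> ` ball 0 1 \<subseteq> ball 0 1"
  proof (rule image_subsetI)
    fix z :: complex assume z: "z \<in> ball 0 1"
    define v where "v = of_real \<sigma> * z"
    have v: "cmod v < 1" using z \<sigma>1 by (simp add: v_def norm_mult)
    have "(cmod (1 + of_real s * v))\<^sup>2 - (cmod (of_real s + v))\<^sup>2 = (1 - s\<^sup>2) * (1 - (cmod v)\<^sup>2)"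
      unfolding cmod_power2 by (simp add: power2_eq_square algebra_simps)
    also have "\<dots> \<ge> 0" using s v by (intro mult_nonneg_nonneg) (auto simp: power_le_one)
    finally have "cmod (of_real s + v) \<le> cmod (1 + of_real s * v)" by (simp add: power2_le_iff_abs_le)
    then have "cmod (g z) \<le> 1" using nz[OF z] by (simp add: g_def v_def norm_divide)
    then have "cmod z * cmod (g z) \<le> cmod z" by (simp add: mult_left_le)
    then show "\<omega> z \<in> ball 0 1" using z unfolding \<omega>g by (simp add: norm_mult)
  qed
  define G where "G = fps_expansion g 0"
  have G: "g has_fps_expansion G"
    unfolding G_def using g by (rule has_fps_expansion_holomorphic_ball) simp
  have "\<omega> has_fps_expansion fps_X * G"
    using has_fps_expansion_mult[OF has_fps_expansion_fps_X G] by (simp add: \<omega>_def g_def)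
  then have W: "fps_nth (fps_expansion \<omega> 0) (Suc n) = fps_nth G n" for n
    by (simp add: fps_expansion_eqI)
  have z: "(\<lambda>z. z * of_real \<sigma>) has_fps_expansion fps_X * fps_const (of_real \<sigma> :: complex)"
    by (intro has_fps_expansion_mult has_fps_expansion_fps_X has_fps_expansion_const)
  have l: "(\<lambda>z. g z * (1 + cnj (of_real s) * (z * of_real \<sigma>))) has_fps_expansion
      G * (1 + fps_const (cnj (of_real s)) * (fps_X * fps_const (of_real \<sigma>)))"
    by (intro has_fps_expansion_mult[OF G] has_fps_expansion_add has_fps_expansion_1
            has_fps_expansion_cmult_left z)
  have r: "(\<lambda>z. of_real s + z * of_real \<sigma>) has_fps_expansion fps_const (of_real s) + fps_X * fps_const (of_real \<sigma> :: complex)"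
    by (intro has_fps_expansion_add has_fps_expansion_const z)
  have "G * (1 + fps_const (cnj (of_real s)) * (fps_X * fps_const (of_real \<sigma>))) = fps_const (of_real s) + fps_X * fps_const (of_real \<sigma> :: complex)"
  proof (rule has_fps_expansion_eqI[OF l r zero_less_one])
    fix z :: complex assume "z \<in> ball 0 1"
    from nz[OF this] show "g z * (1 + cnj (of_real s) * (z * of_real \<sigma>)) = of_real s + z * of_real \<sigma>"
      by (simp add: g_def mult_ac)
  qed
  note C = Schur_step_coeffs[OF this]
  have \<sigma>2: "(of_real \<sigma> :: complex)\<^sup>2 = 1" using \<sigma> by (simp add: power2_eq_square flip: of_real_mult)
  show "fps_nth (fps_expansion \<omega> 0) 1 = of_real s" using W[of 0] C(1) by simp
  show "fps_nth (fps_expansion \<omega> 0) 2 = of_real ((1 - s\<^sup>2) * \<sigma>)"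
    using W[of 1] C(2) by (simp add: numeral_2_eq_2)
  show "fps_nth (fps_expansion \<omega> 0) 3 = of_real (- (1 - s\<^sup>2) * s)"
  proof -
    have "fps_nth G 2 = of_real (1 - s\<^sup>2) * (0 - of_real s)" using C(3) \<sigma>2 by simp
    then show ?thesis using W[of 2] by (simp add: eval_nat_numeral algebra_simps)
  qed
qed

lemma janowski_coeffs:
  fixes A B :: real
  assumes A: "\<bar>A\<bar> \<le> 1" and B: "\<bar>B\<bar> \<le> 1" and BA: "B < A" and f: "f \<in> janowski_convex A B"
  obtains x y w where "cmod x \<le> 1" "cmod y \<le> 1" "cmod w \<le> 1"
    "cmod (log_inverse_coeff f 1) = (A - B) / 4 * cmod x"
    "cmod (log_inverse_coeff f 2) = (A - B) / 12 *
       cmod (of_real (1 - (cmod x)\<^sup>2) * y - of_real ((5 * A - B) / 4) * x\<^sup>2)"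
    "cmod (log_inverse_coeff f 3) = (A - B) / 24 *
       cmod (of_real (1 - (cmod x)\<^sup>2) * (of_real (1 - (cmod y)\<^sup>2) * w - cnj x * y\<^sup>2)
         + of_real ((B - 5 * A) / 2) * x * (of_real (1 - (cmod x)\<^sup>2) * y)
         + of_real ((3 * A\<^sup>2 - A * B) / 2) * x ^ 3)"
proof -
  obtain \<omega> where \<omega>: "\<omega> holomorphic_on ball 0 1" "\<omega> 0 = 0" "\<omega> ` ball 0 1 \<subseteq> ball 0 1"
    and eq: "\<And>z. z \<in> ball 0 1 \<Longrightarrow> 1 + z * deriv (deriv f) z / deriv f z
               = (1 + of_real A * \<omega> z) / (1 + of_real B * \<omega> z)"
    using f unfolding janowski_convex_def subordinate_def by blast
  have f1: "f \<in> normalized_class" "\<And>z. z \<in> ball 0 1 \<Longrightarrow> deriv f z \<noteq> 0"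
    using f unfolding janowski_convex_def by blast+
  note \<Gamma> = log_inverse_coeffs_of_Schwarz_function[OF A B f1 \<omega> eq]
  have n: "cmod (of_real (- (A - B) / 4) * v) = (A - B) / 4 * cmod v"
    "cmod (of_real (- (A - B) / 12) * v) = (A - B) / 12 * cmod v"
    "cmod (of_real (- (A - B) / 24) * v) = (A - B) / 24 * cmod v" for v
    unfolding norm_mult norm_of_real using BA by simp_all
  show thesis
  proof (rule Schwarz_function_coeffs[OF \<omega>])
    fix x y w
    assume xyw: "cmod x \<le> 1" "cmod y \<le> 1" "cmod w \<le> 1"
    assume c: "fps_nth (fps_expansion \<omega> 0) 1 = x"
      "fps_nth (fps_expansion \<omega> 0) 2 = of_real (1 - (cmod x)\<^sup>2) * y"
      "fps_nth (fps_expansion \<omega> 0) 3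
         = of_real (1 - (cmod x)\<^sup>2) * (of_real (1 - (cmod y)\<^sup>2) * w - cnj x * y\<^sup>2)"
    show thesis
      by (rule that[OF xyw]) (simp_all only: \<Gamma> c n)
  qed
qed

lemma janowski_coeffs_attained:
  fixes A B :: real
  assumes A: "\<bar>A\<bar> \<le> 1" and B: "\<bar>B\<bar> \<le> 1" and BA: "B < A"
    and \<omega>: "\<omega> holomorphic_on ball 0 1" "\<omega> 0 = 0" "\<omega> ` ball 0 1 \<subseteq> ball 0 1"
  defines "c \<equiv> fps_nth (fps_expansion \<omega> 0)"
  obtains f where "f \<in> janowski_convex A B"
    "cmod (log_inverse_coeff f 1) = (A - B) / 4 * cmod (c 1)"
    "cmod (log_inverse_coeff f 2) = (A - B) / 12 * cmod (c 2 - of_real ((5 * A - B) / 4) * (c 1)\<^sup>2)"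
    "cmod (log_inverse_coeff f 3) = (A - B) / 24 *
       cmod (c 3 + of_real ((B - 5 * A) / 2) * c 1 * c 2 + of_real ((3 * A\<^sup>2 - A * B) / 2) * c 1 ^ 3)"
proof (rule Janowski_function_with_Schwarz_function[OF A B \<omega>])
  fix f assume f: "f \<in> janowski_convex A B"
    and nz: "\<And>z. z \<in> ball 0 1 \<Longrightarrow> deriv f z \<noteq> 0"
    and eq: "\<And>z. z \<in> ball 0 1 \<Longrightarrow> 1 + z * deriv (deriv f) z / deriv f z
               = (1 + of_real A * \<omega> z) / (1 + of_real B * \<omega> z)"
  have "f \<in> normalized_class" using f by (simp add: janowski_convex_def)
  note \<Gamma> = log_inverse_coeffs_of_Schwarz_function[OF A B this nz \<omega> eq, folded c_def]
  have n: "cmod (of_real (- (A - B) / 4) * v) = (A - B) / 4 * cmod v"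
    "cmod (of_real (- (A - B) / 12) * v) = (A - B) / 12 * cmod v"
    "cmod (of_real (- (A - B) / 24) * v) = (A - B) / 24 * cmod v" for v
    unfolding norm_mult norm_of_real using BA by simp_all
  show thesis
    by (rule that[OF f]) (simp_all only: \<Gamma> n)
qed

lemma power_coeffs:
  assumes "0 < n"
  shows "(\<lambda>z. z ^ n :: complex) holomorphic_on ball 0 1" "(0 :: complex) ^ n = 0"
    and "(\<lambda>z. z ^ n :: complex) ` ball 0 1 \<subseteq> ball 0 1"
    and "fps_nth (fps_expansion (\<lambda>z. z ^ n) 0) k = (if k = n then 1 else 0)"
proof -
  show "(\<lambda>z. z ^ n :: complex) holomorphic_on ball 0 1" by (intro holomorphic_intros)
  show "(0 :: complex) ^ n = 0" using assms by simp
  show "(\<lambda>z. z ^ n :: complex) ` ball 0 1 \<subseteq> ball 0 1"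
    using assms by (auto simp: norm_power power_less_one_iff)
  have "fps_expansion (\<lambda>z::complex. z ^ n) 0 = fps_X ^ n"
    by (intro fps_expansion_eqI has_fps_expansion_fps_X_power)
  then show "fps_nth (fps_expansion (\<lambda>z. z ^ n) 0) k = (if k = n then 1 else 0)" by simp
qed

section \<open>The cubic coefficient functional\<close>

text \<open>
  The quantity to be maximized, for \<open>c\<^sub>1 = r\<close>, is
  \<open>r \<bar>(1 - r\<^sup>2) (\<mu> y - y\<^sup>2) + \<nu> r\<^sup>2\<bar> + (1 - r\<^sup>2) (1 - \<bar>y\<bar>\<^sup>2)\<close>. This is its value at the real point
  \<open>y = - \<rho>\<close>, as long as the expression inside the modulus is negative there.
\<close>

definition edge_value :: "real \<Rightarrow> real \<Rightarrow> real \<Rightarrow> real \<Rightarrow> real" where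
  "edge_value \<mu> \<nu> r \<rho> = r * ((1 - r\<^sup>2) * (\<mu> * \<rho> + \<rho>\<^sup>2) - \<nu> * r\<^sup>2) + (1 - r\<^sup>2) * (1 - \<rho>\<^sup>2)"

text \<open>
  The bound obtained when, for fixed \<open>\<rho> = \<bar>y\<bar>\<close>, the concave quadratic in \<open>Re y\<close> inside the modulus is
  replaced by the value at its vertex, whether or not the vertex is admissible.
\<close>

definition vertex_value :: "real \<Rightarrow> real \<Rightarrow> real \<Rightarrow> real \<Rightarrow> real" where
  "vertex_value \<mu> \<nu> r \<rho> =
     (\<nu> * r\<^sup>2 + (1 - r\<^sup>2) * \<rho>\<^sup>2) * sqrt (r\<^sup>2 + \<mu>\<^sup>2 / (4 * \<nu>) * (1 - r\<^sup>2)) + (1 - r\<^sup>2) * (1 - \<rho>\<^sup>2)"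

lemma edge_value_1: "edge_value \<mu> \<nu> r 1 = r * ((\<mu> + 1) - (\<mu> + 1 + \<nu>) * r\<^sup>2)"
  by (simp add: edge_value_def algebra_simps)

text \<open>
  On the edge \<open>\<rho> = 1\<close> one has to maximize the cubic \<open>r \<mapsto> r (\<mu> + 1 - (\<mu> + 1 + \<nu>) r\<^sup>2)\<close>, whose critical
  point is \<open>s\<close>; the difference to the maximum has the factor \<open>(s - r)\<^sup>2\<close>.
\<close>

lemma edge_value_1_le:
  assumes "0 \<le> r" "0 \<le> s" "0 < \<mu> + 1 + \<nu>" "3 * (\<mu> + 1 + \<nu>) * s\<^sup>2 = \<mu> + 1"
  shows "edge_value \<mu> \<nu> r 1 \<le> 2/3 * (\<mu> + 1) * s"
proof -
  define K where "K = \<mu> + 1 + \<nu>"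
  have K: "\<mu> + 1 = 3 * K * s\<^sup>2" using assms(4) by (simp add: K_def)
  have "edge_value \<mu> \<nu> r 1 = r * (3 * K * s\<^sup>2 - K * r\<^sup>2)"
    unfolding edge_value_1 K[symmetric] by (simp add: K_def)
  then have "2/3 * (\<mu> + 1) * s - edge_value \<mu> \<nu> r 1 = K * ((s - r)\<^sup>2 * (2 * s + r))"
    unfolding K by (simp add: power2_eq_square algebra_simps)
  also have "\<dots> \<ge> 0"
    using assms by (intro mult_nonneg_nonneg) (auto simp: K_def)
  finally show ?thesis by simp
qed

text \<open>
  As a function of \<open>\<rho>\<close> the edge value is a concave parabola. For \<open>r (2 + \<mu>) \<ge> 2\<close> it increases on
  \<open>[0, 1]\<close> and \<open>\<rho> = 1\<close> is the worst case. For smaller \<open>r\<close> its vertex value is \<open>\<phi> r\<close>, where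
  \<open>\<phi> - 1\<close> is \<open>r\<^sup>2\<close> times an increasing function. So \<open>\<phi> r\<close> is at most \<open>1\<close> or at most the value at
  the transition point \<open>t = 2 / (2 + \<mu>)\<close>, which is again an edge value with \<open>\<rho> = 1\<close>.
\<close>

lemma edge_value_le:
  assumes r: "0 \<le> r" "r \<le> 1" and \<rho>: "0 \<le> \<rho>" "\<rho> \<le> 1" and \<mu>: "0 \<le> \<mu>" and \<nu>: "\<nu> \<le> \<mu>\<^sup>2 / 4"
    and s: "0 \<le> s" "0 < \<mu> + 1 + \<nu>" "3 * (\<mu> + 1 + \<nu>) * s\<^sup>2 = \<mu> + 1"
  shows "edge_value \<mu> \<nu> r \<rho> \<le> max 1 (2/3 * (\<mu> + 1) * s)"
proof (cases "2 \<le> r * (2 + \<mu>)")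
  case True
  have "edge_value \<mu> \<nu> r 1 - edge_value \<mu> \<nu> r \<rho>
      = (1 - r\<^sup>2) * (1 - \<rho>) * ((r * (2 + \<mu>) - 2) + (1 - r) * (1 - \<rho>))"
    unfolding edge_value_def by (simp add: power2_eq_square algebra_simps)
  also have "\<dots> \<ge> 0"
    using r \<rho> True by (intro mult_nonneg_nonneg add_nonneg_nonneg) (auto simp: power_le_one)
  finally show ?thesis
    using edge_value_1_le[OF r(1) s] by linarith
next
  case False
  define \<phi> where "\<phi> t = 1 + t\<^sup>2 * (\<mu>\<^sup>2 / 4 - 1 + t * (\<mu>\<^sup>2 / 4 - \<nu>))" for t :: real
  have r1: "r < 1"
  proof (rule ccontr)
    assume "\<not> r < 1"
    then have "r = 1" using r by simp
    then show False using False \<mu> by simp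
  qed
  have "4 * (1 - r) * (\<phi> r - edge_value \<mu> \<nu> r \<rho>) = (1 - r\<^sup>2) * (r * \<mu> - 2 * (1 - r) * \<rho>)\<^sup>2"
    unfolding edge_value_def \<phi>_def by (simp add: power2_eq_square field_simps)
  also have "\<dots> \<ge> 0"
    using r by (intro mult_nonneg_nonneg) (auto simp: power_le_one)
  finally have 1: "edge_value \<mu> \<nu> r \<rho> \<le> \<phi> r"
    using r1 by (simp add: zero_le_mult_iff)
  define t where "t = 2 / (2 + \<mu>)"
  have t: "t * (2 + \<mu>) = 2" "r \<le> t" "0 \<le> t"
    using False \<mu> by (auto simp: t_def field_simps)
  have t\<mu>: "t * \<mu> = 2 - 2 * t" using t(1) by (simp add: algebra_simps)
  have "\<phi> t = 1 + (t * \<mu>)\<^sup>2 / 4 - t\<^sup>2 + t * ((t * \<mu>)\<^sup>2 / 4) - t ^ 3 * \<nu>"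
    unfolding \<phi>_def by (simp add: power2_eq_square power3_eq_cube algebra_simps)
  moreover have "edge_value \<mu> \<nu> t 1 = t * \<mu> + t - t\<^sup>2 * (t * \<mu>) - t ^ 3 - t ^ 3 * \<nu>"
    unfolding edge_value_1 by (simp add: power2_eq_square power3_eq_cube algebra_simps)
  ultimately have "\<phi> t = edge_value \<mu> \<nu> t 1"
    unfolding t\<mu> by (simp add: power2_eq_square power3_eq_cube field_simps)
  then have 2: "\<phi> t \<le> 2/3 * (\<mu> + 1) * s"
    using edge_value_1_le[OF t(3) s] by simp
  have "\<phi> r \<le> max 1 (\<phi> t)"
  proof (cases "\<mu>\<^sup>2 / 4 - 1 + r * (\<mu>\<^sup>2 / 4 - \<nu>) \<le> 0")
    case True
    then have "r\<^sup>2 * (\<mu>\<^sup>2 / 4 - 1 + r * (\<mu>\<^sup>2 / 4 - \<nu>)) \<le> 0"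
      by (intro mult_nonneg_nonpos) auto
    then show ?thesis unfolding \<phi>_def by simp
  next
    case False
    have "r * (\<mu>\<^sup>2 / 4 - \<nu>) \<le> t * (\<mu>\<^sup>2 / 4 - \<nu>)"
      using t \<nu> by (intro mult_right_mono) auto
    then have "r\<^sup>2 * (\<mu>\<^sup>2 / 4 - 1 + r * (\<mu>\<^sup>2 / 4 - \<nu>)) \<le> t\<^sup>2 * (\<mu>\<^sup>2 / 4 - 1 + t * (\<mu>\<^sup>2 / 4 - \<nu>))"
      using False t r by (intro mult_mono power_mono) auto
    then show ?thesis unfolding \<phi>_def by simp
  qed
  with 1 2 show ?thesis by linarith
qed

text \<open>
  With \<open>T = 1 - r\<^sup>2\<close>, \<open>N = \<nu> r\<^sup>2\<close> and \<open>c = Re y\<close>, the squared modulus \<open>P\<close> is a quadratic polynomial in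
  \<open>c\<close> with leading coefficient \<open>- 4 N T\<close>. The condition of the first part says that \<open>P\<close> is convex
  with a nonpositive linear coefficient, or that its vertex lies at or to the left of \<open>c = - \<rho>\<close>. In both
  cases \<open>c = - \<rho>\<close> is the worst case. The second part holds for every concave \<open>P\<close>.
\<close>

lemma coefficient_value_cases:
  fixes y :: complex and r \<mu> \<nu> :: real
  assumes r: "0 \<le> r" "r \<le> 1" and \<mu>: "0 \<le> \<mu>" and \<nu>: "\<nu> \<le> \<mu>\<^sup>2 / 4"
  defines "V \<equiv> r * cmod (of_real (1 - r\<^sup>2) * (- (y\<^sup>2) + of_real \<mu> * y) + of_real (\<nu> * r\<^sup>2))
                + (1 - r\<^sup>2) * (1 - (cmod y)\<^sup>2)"
    and "\<rho> \<equiv> cmod y"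
  shows "\<nu> \<le> 0 \<or> 4 * (\<nu> * r\<^sup>2) * \<rho> \<le> \<mu> * ((1 - r\<^sup>2) * \<rho>\<^sup>2 - \<nu> * r\<^sup>2) \<Longrightarrow> V \<le> edge_value \<mu> \<nu> r \<rho>"
    and "\<nu> > 0 \<Longrightarrow> V \<le> vertex_value \<mu> \<nu> r \<rho>"
proof -
  define T N c where "T = 1 - r\<^sup>2" and "N = \<nu> * r\<^sup>2" and "c = Re y"
  define P where "P = (cmod (of_real T * (- (y\<^sup>2) + of_real \<mu> * y) + of_real N))\<^sup>2"
  have T: "0 \<le> T" using r by (simp add: T_def power_le_one)
  have \<rho>: "0 \<le> \<rho>" and c: "\<bar>c\<bar> \<le> \<rho>" by (auto simp: \<rho>_def c_def abs_Re_le_cmod)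
  have \<rho>2: "\<rho>\<^sup>2 = c\<^sup>2 + (Im y)\<^sup>2" by (simp add: \<rho>_def c_def cmod_power2)
  have P: "P = (N + T * \<rho>\<^sup>2)\<^sup>2 + (T * \<mu> * \<rho>)\<^sup>2 + 2 * T * \<mu> * (N - T * \<rho>\<^sup>2) * c - 4 * N * T * c\<^sup>2"
    unfolding P_def power_mult_distrib \<rho>2 unfolding cmod_power2
    by (simp add: c_def power2_eq_square algebra_simps)
  have V: "V = r * sqrt P + T * (1 - \<rho>\<^sup>2)"
    by (simp add: V_def P_def T_def N_def \<rho>_def)
  show "V \<le> edge_value \<mu> \<nu> r \<rho>" if "\<nu> \<le> 0 \<or> 4 * (\<nu> * r\<^sup>2) * \<rho> \<le> \<mu> * ((1 - r\<^sup>2) * \<rho>\<^sup>2 - \<nu> * r\<^sup>2)"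
  proof -
    have A: "N \<le> 0 \<or> (0 \<le> N \<and> 4 * N * \<rho> \<le> \<mu> * (T * \<rho>\<^sup>2 - N))"
      using that unfolding N_def T_def by (cases "\<nu> \<le> 0") (auto simp: mult_nonpos_nonneg)
    have d: "4 * N * (\<rho> - c) \<le> 2 * \<mu> * (T * \<rho>\<^sup>2 - N)"
    proof (cases "N \<le> 0")
      case True
      then have "4 * N * (\<rho> - c) \<le> 0" using c by (simp add: mult_nonpos_nonneg)
      moreover have "0 \<le> 2 * \<mu> * (T * \<rho>\<^sup>2 - N)"
        using True \<mu> T by (simp add: order_trans[of N 0])
      ultimately show ?thesis by linarith
    next
      case False
      then have "4 * N * (\<rho> - c) \<le> 4 * N * (2 * \<rho>)"
        using c by (intro mult_left_mono) auto
      with A False show ?thesis by linarith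
    qed
    have pos: "0 \<le> T * \<mu> * \<rho> + T * \<rho>\<^sup>2 - N"
    proof (cases "N \<le> 0")
      case True
      have "0 \<le> T * \<mu> * \<rho>" "0 \<le> T * \<rho>\<^sup>2" using T \<mu> \<rho> by auto
      with True show ?thesis by linarith
    next
      case False
      then have "0 \<le> \<mu> * (T * \<rho>\<^sup>2 - N)" using A \<rho> by (smt (verit) mult_nonneg_nonneg)
      moreover have "\<mu> \<noteq> 0" using False \<nu> by (auto simp: N_def mult_le_0_iff)
      ultimately have "0 \<le> T * \<rho>\<^sup>2 - N" using \<mu> by (simp add: zero_le_mult_iff)
      moreover have "0 \<le> T * \<mu> * \<rho>" using T \<mu> \<rho> by auto
      ultimately show ?thesis by linarith
    qed
    have "(T * \<mu> * \<rho> + T * \<rho>\<^sup>2 - N)\<^sup>2 - P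
        = T * (\<rho> + c) * (2 * \<mu> * (T * \<rho>\<^sup>2 - N) - 4 * N * (\<rho> - c))"
      unfolding P by (simp add: power2_eq_square algebra_simps)
    also have "\<dots> \<ge> 0" using T c d by (intro mult_nonneg_nonneg) auto
    finally have "sqrt P \<le> T * \<mu> * \<rho> + T * \<rho>\<^sup>2 - N"
      using pos by (intro real_le_lsqrt) auto
    then have "r * sqrt P \<le> r * (T * \<mu> * \<rho> + T * \<rho>\<^sup>2 - N)" using r by (intro mult_left_mono)
    then show ?thesis unfolding V edge_value_def T_def N_def by (simp add: algebra_simps)
  qed
  show "V \<le> vertex_value \<mu> \<nu> r \<rho>" if \<nu>0: "\<nu> > 0"
  proof -
    define W where "W = r\<^sup>2 + \<mu>\<^sup>2 / (4 * \<nu>) * T"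
    have W: "4 * \<nu> * W = 4 * N + \<mu>\<^sup>2 * T"
      using \<nu>0 by (simp add: W_def N_def field_simps)
    have "4 * \<nu> * ((N + T * \<rho>\<^sup>2)\<^sup>2 * W - r\<^sup>2 * P) = (N + T * \<rho>\<^sup>2)\<^sup>2 * (4 * \<nu> * W) - 4 * N * P"
      by (simp add: N_def right_diff_distrib)
    also have "\<dots> = T * (4 * N * c - \<mu> * (N - T * \<rho>\<^sup>2))\<^sup>2"
      unfolding P W by (simp add: power2_eq_square algebra_simps)
    also have "\<dots> \<ge> 0" using T by simp
    finally have "r\<^sup>2 * P \<le> (N + T * \<rho>\<^sup>2)\<^sup>2 * W"
      using \<nu>0 by (simp add: zero_le_mult_iff)
    then have "sqrt (r\<^sup>2 * P) \<le> sqrt ((N + T * \<rho>\<^sup>2)\<^sup>2 * W)"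
      by (rule real_sqrt_le_mono)
    moreover have "0 \<le> N + T * \<rho>\<^sup>2" using \<nu>0 T by (simp add: N_def)
    ultimately have "r * sqrt P \<le> (N + T * \<rho>\<^sup>2) * sqrt W"
      using r by (simp add: real_sqrt_mult)
    then show ?thesis unfolding V vertex_value_def W_def T_def N_def by simp
  qed
qed

lemma vertex_value_mono:
  assumes r: "0 \<le> r" "r \<le> 1" and \<nu>: "0 < \<nu>" "\<nu> \<le> \<mu>\<^sup>2 / 4" and \<rho>: "0 \<le> \<rho>" "\<rho> \<le> \<rho>'"
  shows "vertex_value \<mu> \<nu> r \<rho> \<le> vertex_value \<mu> \<nu> r \<rho>'"
proof -
  define S where "S = sqrt (r\<^sup>2 + \<mu>\<^sup>2 / (4 * \<nu>) * (1 - r\<^sup>2))"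
  have "1 * (1 - r\<^sup>2) \<le> \<mu>\<^sup>2 / (4 * \<nu>) * (1 - r\<^sup>2)"
    using r \<nu> by (intro mult_right_mono) (auto simp: power_le_one field_simps)
  then have S: "1 \<le> S" by (simp add: S_def)
  have "vertex_value \<mu> \<nu> r \<rho>' - vertex_value \<mu> \<nu> r \<rho> = (1 - r\<^sup>2) * (\<rho>'\<^sup>2 - \<rho>\<^sup>2) * (S - 1)"
    unfolding vertex_value_def S_def[symmetric] by (simp add: algebra_simps)
  also have "\<dots> \<ge> 0"
    using r \<rho> S by (intro mult_nonneg_nonneg) (auto simp: power_le_one power_mono)
  finally show ?thesis by simp
qed

text \<open>
  The hypothesis places the vertex exactly at the endpoint \<open>Re y = - \<rho>\<close>, where both values coincide.
\<close>

lemma vertex_value_le_edge_value: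
  assumes r: "0 \<le> r" "r \<le> 1" and \<mu>: "0 < \<mu>" and \<nu>: "0 < \<nu>" and \<rho>: "0 \<le> \<rho>"
    and eq: "\<mu> * ((1 - r\<^sup>2) * \<rho>\<^sup>2 - \<nu> * r\<^sup>2) = 4 * (\<nu> * r\<^sup>2) * \<rho>"
  shows "vertex_value \<mu> \<nu> r \<rho> \<le> edge_value \<mu> \<nu> r \<rho>"
proof -
  define T N W where "T = 1 - r\<^sup>2" and "N = \<nu> * r\<^sup>2" and "W = r\<^sup>2 + \<mu>\<^sup>2 / (4 * \<nu>) * (1 - r\<^sup>2)"
  define E where "E = T * \<mu> * \<rho> + T * \<rho>\<^sup>2 - N"
  have T: "0 \<le> T" using r by (simp add: T_def power_le_one)
  have N: "0 \<le> N" using \<nu> by (simp add: N_def)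
  have eq': "\<mu> * (T * \<rho>\<^sup>2 - N) = 4 * N * \<rho>" using eq by (simp add: T_def N_def)
  have "0 \<le> \<mu> * (T * \<rho>\<^sup>2 - N)" using eq' N \<rho> by simp
  then have "0 \<le> T * \<rho>\<^sup>2 - N" using \<mu> by (simp add: zero_le_mult_iff)
  moreover have "0 \<le> T * \<mu> * \<rho>" using T \<mu> \<rho> by simp
  ultimately have E: "0 \<le> E" unfolding E_def by linarith
  have W: "4 * \<nu> * W = 4 * N + \<mu>\<^sup>2 * T"
    using \<nu> by (simp add: W_def N_def T_def field_simps)
  have "4 * \<nu> * ((N + T * \<rho>\<^sup>2)\<^sup>2 * W - (r * E)\<^sup>2) = (N + T * \<rho>\<^sup>2)\<^sup>2 * (4 * \<nu> * W) - 4 * N * E\<^sup>2"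
    by (simp add: N_def right_diff_distrib power_mult_distrib)
  also have "\<dots> = T * (\<mu> * (T * \<rho>\<^sup>2 - N) - 4 * N * \<rho>)\<^sup>2"
    unfolding W E_def by (simp add: power2_eq_square algebra_simps)
  finally have "(N + T * \<rho>\<^sup>2)\<^sup>2 * W = (r * E)\<^sup>2"
    using \<nu> eq' by simp
  then have "sqrt ((N + T * \<rho>\<^sup>2)\<^sup>2 * W) = sqrt ((r * E)\<^sup>2)"
    by simp
  then have "(N + T * \<rho>\<^sup>2) * sqrt W = r * E"
    using N T r E by (simp add: real_sqrt_mult)
  then show ?thesis
    unfolding vertex_value_def edge_value_def W_def[symmetric] unfolding T_def N_def E_def
    by (simp add: algebra_simps)
qed

text \<open>
  The vertex value increases with \<open>\<rho>\<close>. If the vertex is to the right of \<open>Re y = - \<rho>\<close>, increase \<open>\<rho>\<close> until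
  it meets the endpoint, where the vertex value is an edge value. If that never happens, \<open>\<rho> = 1\<close> is
  reached.
\<close>

lemma vertex_value_climb:
  assumes r: "0 \<le> r" "r \<le> 1" and \<mu>: "0 < \<mu>" and \<nu>: "0 < \<nu>" "\<nu> \<le> \<mu>\<^sup>2 / 4" and \<rho>: "0 \<le> \<rho>" "\<rho> \<le> 1"
    and inner: "\<mu> * ((1 - r\<^sup>2) * \<rho>\<^sup>2 - \<nu> * r\<^sup>2) \<le> 4 * (\<nu> * r\<^sup>2) * \<rho>"
  obtains \<rho>' where "0 \<le> \<rho>'" "\<rho>' \<le> 1" "vertex_value \<mu> \<nu> r \<rho> \<le> edge_value \<mu> \<nu> r \<rho>'"
  | "\<mu> * (1 - r\<^sup>2 - \<nu> * r\<^sup>2) \<le> 4 * (\<nu> * r\<^sup>2)" "vertex_value \<mu> \<nu> r \<rho> \<le> vertex_value \<mu> \<nu> r 1"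
proof (cases "\<mu> * (1 - r\<^sup>2 - \<nu> * r\<^sup>2) \<le> 4 * (\<nu> * r\<^sup>2)")
  case True
  then show thesis using that(2) vertex_value_mono[OF r \<nu> \<rho>] by blast
next
  case False
  define \<delta> where "\<delta> t = \<mu> * ((1 - r\<^sup>2) * t\<^sup>2 - \<nu> * r\<^sup>2) - 4 * (\<nu> * r\<^sup>2) * t" for t
  have "\<exists>t\<ge>\<rho>. t \<le> 1 \<and> \<delta> t = 0"
    using inner False \<rho> by (intro IVT') (auto simp: \<delta>_def intro!: continuous_intros)
  then obtain t where t: "\<rho> \<le> t" "t \<le> 1" "\<delta> t = 0" by blast
  have "vertex_value \<mu> \<nu> r \<rho> \<le> vertex_value \<mu> \<nu> r t"
    by (rule vertex_value_mono[OF r \<nu> \<rho>(1) t(1)])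
  also have "\<dots> \<le> edge_value \<mu> \<nu> r t"
    using t \<rho> by (intro vertex_value_le_edge_value[OF r \<mu> \<nu>(1)]) (auto simp: \<delta>_def)
  finally show thesis using that(1) t \<rho> by (meson order_trans)
qed

lemma vertex_value_1:
  assumes "0 < \<nu>" "0 \<le> r" "r \<le> 1"
  shows "vertex_value \<mu> \<nu> r 1
     = sqrt ((1 + (\<nu> - 1) * r\<^sup>2)\<^sup>2 * (1 + (\<mu>\<^sup>2 / (4 * \<nu>) - 1) * (1 - r\<^sup>2)))"
proof -
  have "0 \<le> \<nu> * r\<^sup>2 + (1 - r\<^sup>2)" using assms by (auto simp: power_le_one)
  moreover have e: "\<nu> * r\<^sup>2 + (1 - r\<^sup>2) = 1 + (\<nu> - 1) * r\<^sup>2" by (simp add: algebra_simps)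
  moreover have "r\<^sup>2 + \<mu>\<^sup>2 / (4 * \<nu>) * (1 - r\<^sup>2) = 1 + (\<mu>\<^sup>2 / (4 * \<nu>) - 1) * (1 - r\<^sup>2)"
    by (simp add: algebra_simps)
  ultimately show ?thesis
    unfolding vertex_value_def by (simp add: real_sqrt_mult)
qed

text \<open>
  For \<open>a = \<nu> - 1\<close>, \<open>b = \<mu>\<^sup>2 / (4 \<nu>) - 1\<close>, \<open>x = r\<^sup>2\<close> this cubic is the square of the vertex value at
  \<open>\<rho> = 1\<close>. On \<open>[0, 1]\<close> the factor \<open>1 + a x\<close> is positive, so the affine factor decides the monotonicity.
\<close>

lemma cubic_has_derivative:
  "((\<lambda>x. (1 + a * x)\<^sup>2 * (1 + b * (1 - x))) has_real_derivative
     (1 + a * x) * (2 * a * (1 + b) - b - 3 * a * b * x)) (at x)"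
  by (auto intro!: derivative_eq_intros simp: power2_eq_square algebra_simps)

lemma cubic_decreasing:
  fixes a b :: real
  assumes a: "-1 < a" and b: "0 \<le> b" and x: "0 \<le> x" "x \<le> z" "z \<le> 1"
    and sgn: "a \<le> 0 \<or> 2 * a * (1 + b) - b - 3 * a * b * x \<le> 0"
  shows "(1 + a * z)\<^sup>2 * (1 + b * (1 - z)) \<le> (1 + a * x)\<^sup>2 * (1 + b * (1 - x))"
proof (rule DERIV_nonpos_imp_nonincreasing[OF x(2)])
  fix t assume t: "x \<le> t" "t \<le> z"
  have pos: "0 \<le> 1 + a * t"
  proof (cases "a \<le> 0")
    case True
    then have "a * t \<ge> a * 1" using t x by (intro mult_left_mono_neg) auto
    then show ?thesis using a by simp
  next
    case False
    then show ?thesis using t x by simp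
  qed
  have "2 * a * (1 + b) - b - 3 * a * b * t \<le> 0"
  proof (cases "a \<le> 0")
    case True
    have "2 * a * (1 + b) - b - 3 * a * b * t = 2 * a * (1 + b * (1 - t)) - b * (1 + a * t)"
      by (simp add: algebra_simps)
    moreover have "2 * a * (1 + b * (1 - t)) \<le> 0"
      by (rule mult_nonpos_nonneg) (use True b t x in auto)
    moreover have "0 \<le> b * (1 + a * t)" using b pos by simp
    ultimately show ?thesis by linarith
  next
    case False
    then have "3 * a * b * x \<le> 3 * a * b * t" using b t by (intro mult_left_mono) auto
    then show ?thesis using sgn False by linarith
  qed
  then show "\<exists>y. ((\<lambda>x. (1 + a * x)\<^sup>2 * (1 + b * (1 - x))) has_real_derivative y) (at t) \<and> y \<le> 0"
    using pos cubic_has_derivative by (meson mult_nonneg_nonpos)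
qed

lemma cubic_le_at_1:
  fixes a b :: real
  assumes a: "0 \<le> a" and b: "0 \<le> b" and x: "0 \<le> x" "x \<le> 1"
    and sgn: "0 \<le> 2 * a * (1 + b) - b - 3 * a * b"
  shows "(1 + a * x)\<^sup>2 * (1 + b * (1 - x)) \<le> (1 + a)\<^sup>2"
proof -
  have "(1 + a * x)\<^sup>2 * (1 + b * (1 - x)) \<le> (1 + a * 1)\<^sup>2 * (1 + b * (1 - 1))"
  proof (rule DERIV_nonneg_imp_nondecreasing[OF x(2)])
    fix t assume t: "x \<le> t" "t \<le> 1"
    have "3 * a * b * t \<le> 3 * a * b * 1" using a b t by (intro mult_left_mono) auto
    then have "0 \<le> 2 * a * (1 + b) - b - 3 * a * b * t" using sgn by simp
    moreover have "0 \<le> 1 + a * t" using a t x by simp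
    ultimately show "\<exists>y. ((\<lambda>x. (1 + a * x)\<^sup>2 * (1 + b * (1 - x))) has_real_derivative y) (at t) \<and> 0 \<le> y"
      using cubic_has_derivative by (meson mult_nonneg_nonneg)
  qed
  then show ?thesis by simp
qed

text \<open>
  The point \<open>x\<close> is the smallest \<open>r\<^sup>2\<close> allowed by the hypothesis \<open>inner\<close>; there the vertex value equals an
  edge value. The hypothesis \<open>dec\<close> says, when \<open>\<nu> > 1\<close>, exactly that the cubic does not increase at
  \<open>x\<close>, and this persists to the right of \<open>x\<close>.
\<close>

lemma vertex_value_1_le:
  assumes r: "0 \<le> r" "r \<le> 1" and \<mu>: "0 < \<mu>" and \<nu>: "0 < \<nu>" "\<nu> \<le> \<mu>\<^sup>2 / 4"
    and s: "0 \<le> s" "0 < \<mu> + 1 + \<nu>" "3 * (\<mu> + 1 + \<nu>) * s\<^sup>2 = \<mu> + 1"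
    and inner: "\<mu> * (1 - r\<^sup>2 - \<nu> * r\<^sup>2) \<le> 4 * (\<nu> * r\<^sup>2)"
    and dec: "\<nu> \<le> 1 \<or> \<nu> * (\<mu>\<^sup>2 + 2 * \<mu> + 4) \<le> 2 * \<mu> * (\<mu> + 1)"
  shows "vertex_value \<mu> \<nu> r 1 \<le> 2/3 * (\<mu> + 1) * s"
proof -
  define d where "d = \<mu> + \<mu> * \<nu> + 4 * \<nu>"
  define x where "x = \<mu> / d"
  define a b where "a = \<nu> - 1" and "b = \<mu>\<^sup>2 / (4 * \<nu>) - 1"
  have d: "0 < d" using \<mu> \<nu> by (simp add: d_def add_pos_pos)
  have dx: "d * x = \<mu>" using d by (simp add: x_def)
  have b: "0 \<le> b" using \<nu> by (simp add: b_def field_simps)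
  have \<nu>b: "4 * \<nu> * b = \<mu>\<^sup>2 - 4 * \<nu>" using \<nu> by (simp add: b_def field_simps)
  have x: "0 \<le> x" "x \<le> r\<^sup>2"
    using \<mu> d inner by (auto simp: x_def d_def field_simps)
  have r2: "r\<^sup>2 \<le> 1" using r by (simp add: power_le_one)
  have sx: "sqrt x \<le> 1" "(sqrt x)\<^sup>2 = x" using x r2 by auto
  have "a \<le> 0 \<or> 2 * a * (1 + b) - b - 3 * a * b * x \<le> 0"
  proof (cases "\<nu> \<le> 1")
    case False
    have "4 * \<nu> * d * (2 * a * (1 + b) - b - 3 * a * b * x)
      = (2 * a * (4 * \<nu> + 4 * \<nu> * b) - 4 * \<nu> * b) * d - 3 * a * (4 * \<nu> * b) * (d * x)"
      by (simp add: algebra_simps)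
    also have "\<dots> = (2 * a * \<mu>\<^sup>2 - (\<mu>\<^sup>2 - 4 * \<nu>)) * d - 3 * a * (\<mu>\<^sup>2 - 4 * \<nu>) * \<mu>"
      unfolding \<nu>b dx by simp
    also have "\<dots> = 2 * \<nu> * (\<mu> + 2) * (\<nu> * (\<mu>\<^sup>2 + 2 * \<mu> + 4) - 2 * \<mu> * (\<mu> + 1))"
      unfolding d_def a_def by (simp add: power2_eq_square algebra_simps)
    also have "\<dots> \<le> 0"
      using False dec \<mu> \<nu> by (intro mult_nonneg_nonpos) auto
    finally show ?thesis using \<nu> d by (simp add: mult_le_0_iff)
  qed (simp add: a_def)
  then have "(1 + a * r\<^sup>2)\<^sup>2 * (1 + b * (1 - r\<^sup>2)) \<le> (1 + a * x)\<^sup>2 * (1 + b * (1 - x))"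
    using x r2 b \<nu> by (intro cubic_decreasing) (auto simp: a_def)
  then have "vertex_value \<mu> \<nu> r 1 \<le> vertex_value \<mu> \<nu> (sqrt x) 1"
    using r x sx \<nu> by (simp add: vertex_value_1 a_def b_def)
  also have "\<dots> \<le> edge_value \<mu> \<nu> (sqrt x) 1"
  proof (rule vertex_value_le_edge_value)
    have "\<mu> * (1 - x - \<nu> * x) - 4 * (\<nu> * x) = \<mu> - d * x"
      by (simp add: d_def algebra_simps)
    then show "\<mu> * ((1 - (sqrt x)\<^sup>2) * 1\<^sup>2 - \<nu> * (sqrt x)\<^sup>2) = 4 * (\<nu> * (sqrt x)\<^sup>2) * 1"
      unfolding sx dx by simp
  qed (use x sx \<mu> \<nu> in auto)
  also have "\<dots> \<le> 2/3 * (\<mu> + 1) * s"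
    using x s by (intro edge_value_1_le) auto
  finally show ?thesis .
qed

text \<open>
  The lower bound on \<open>\<nu>\<close> says exactly that the cubic does not decrease at \<open>r = 1\<close>. As the relevant
  factor of its derivative decreases, it is then largest at \<open>r = 1\<close>, where it equals \<open>\<nu>\<^sup>2\<close>.
\<close>

lemma vertex_value_1_le_nu:
  assumes r: "0 \<le> r" "r \<le> 1" and \<nu>: "1 \<le> \<nu>" "\<nu> \<le> \<mu>\<^sup>2 / 4" and D: "(\<mu>\<^sup>2 + 8) / 12 \<le> \<nu>"
  shows "vertex_value \<mu> \<nu> r 1 \<le> \<nu>"
proof -
  define b where "b = \<mu>\<^sup>2 / (4 * \<nu>) - 1"
  have b: "0 \<le> b" using \<nu> by (simp add: b_def field_simps)
  have \<nu>b: "\<nu> * b = \<mu>\<^sup>2 / 4 - \<nu>" using \<nu> by (simp add: b_def field_simps)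
  have "2 * (\<nu> - 1) * (1 + b) - b - 3 * (\<nu> - 1) * b = 2 * \<nu> - 2 - \<nu> * b"
    by (simp add: algebra_simps)
  also have "\<dots> \<ge> 0" unfolding \<nu>b using D by simp
  finally have "(1 + (\<nu> - 1) * r\<^sup>2)\<^sup>2 * (1 + b * (1 - r\<^sup>2)) \<le> (1 + (\<nu> - 1))\<^sup>2"
    using r \<nu> b by (intro cubic_le_at_1) (auto simp: power_le_one)
  then show ?thesis
    using r \<nu> by (subst vertex_value_1) (auto simp: b_def intro!: real_le_lsqrt)
qed

lemma coefficient_value_le:
  fixes y :: complex and r \<mu> \<nu> s :: real
  assumes r: "0 \<le> r" "r \<le> 1" and y: "cmod y \<le> 1" and \<mu>: "0 \<le> \<mu>" and \<nu>: "\<nu> \<le> \<mu>\<^sup>2 / 4"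
    and s: "0 \<le> s" "0 < \<mu> + 1 + \<nu>" "3 * (\<mu> + 1 + \<nu>) * s\<^sup>2 = \<mu> + 1"
  defines "V \<equiv> r * cmod (of_real (1 - r\<^sup>2) * (- (y\<^sup>2) + of_real \<mu> * y) + of_real (\<nu> * r\<^sup>2))
                + (1 - r\<^sup>2) * (1 - (cmod y)\<^sup>2)"
  shows "\<nu> \<le> 1 \<or> \<nu> * (\<mu>\<^sup>2 + 2 * \<mu> + 4) \<le> 2 * \<mu> * (\<mu> + 1) \<Longrightarrow> V \<le> max 1 (2/3 * (\<mu> + 1) * s)"
    and "1 \<le> \<nu> \<Longrightarrow> (\<mu>\<^sup>2 + 8) / 12 \<le> \<nu> \<Longrightarrow> V \<le> max \<nu> (2/3 * (\<mu> + 1) * s)"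
proof -
  have "V \<le> max 1 (2/3 * (\<mu> + 1) * s) \<or> (0 < \<nu> \<and> 0 < \<mu> \<and>
          \<mu> * (1 - r\<^sup>2 - \<nu> * r\<^sup>2) \<le> 4 * (\<nu> * r\<^sup>2) \<and> V \<le> vertex_value \<mu> \<nu> r 1)"
  proof (cases "\<nu> \<le> 0 \<or> 4 * (\<nu> * r\<^sup>2) * cmod y \<le> \<mu> * ((1 - r\<^sup>2) * (cmod y)\<^sup>2 - \<nu> * r\<^sup>2)")
    case True
    have "V \<le> edge_value \<mu> \<nu> r (cmod y)"
      unfolding V_def by (rule coefficient_value_cases(1)[OF r \<mu> \<nu> True])
    also have "\<dots> \<le> max 1 (2/3 * (\<mu> + 1) * s)"
      by (rule edge_value_le[OF r _ y \<mu> \<nu> s]) simp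
    finally show ?thesis ..
  next
    case False
    then have \<nu>0: "0 < \<nu>" by simp
    have \<mu>0: "0 < \<mu>" using \<nu> \<nu>0 \<mu> by (cases "\<mu> = 0") auto
    have le: "V \<le> vertex_value \<mu> \<nu> r (cmod y)"
      unfolding V_def by (rule coefficient_value_cases(2)[OF r \<mu> \<nu> \<nu>0])
    show ?thesis
    proof (rule vertex_value_climb[OF r \<mu>0 \<nu>0 \<nu> norm_ge_zero y])
      show "\<mu> * ((1 - r\<^sup>2) * (cmod y)\<^sup>2 - \<nu> * r\<^sup>2) \<le> 4 * (\<nu> * r\<^sup>2) * cmod y"
        using False by simp
    next
      fix \<rho>' assume "0 \<le> \<rho>'" "\<rho>' \<le> 1" "vertex_value \<mu> \<nu> r (cmod y) \<le> edge_value \<mu> \<nu> r \<rho>'"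
      then show ?thesis using le edge_value_le[OF r _ _ \<mu> \<nu> s, of \<rho>'] by linarith
    qed (use le \<nu>0 \<mu>0 in linarith)
  qed
  then show "\<nu> \<le> 1 \<or> \<nu> * (\<mu>\<^sup>2 + 2 * \<mu> + 4) \<le> 2 * \<mu> * (\<mu> + 1) \<Longrightarrow> V \<le> max 1 (2/3 * (\<mu> + 1) * s)"
    and "1 \<le> \<nu> \<Longrightarrow> (\<mu>\<^sup>2 + 8) / 12 \<le> \<nu> \<Longrightarrow> V \<le> max \<nu> (2/3 * (\<mu> + 1) * s)"
    using vertex_value_1_le[OF r _ _ \<nu> s] vertex_value_1_le_nu[OF r _ \<nu>] by linarith+
qed

text \<open>
  Rotation: for \<open>x = r u\<close> with \<open>\<bar>u\<bar> = 1\<close> all terms of the functional acquire the factor \<open>u\<^sup>3\<close> when \<open>y\<close>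
  is divided by \<open>u\<^sup>2\<close>. A change of sign of \<open>y\<close> replaces \<open>\<mu>\<close> by \<open>\<bar>\<mu>\<bar>\<close>, and the triangle inequality
  eliminates \<open>w\<close>.
\<close>

lemma cubic_functional_le:
  fixes x y w :: complex and \<mu> \<nu> :: real
  assumes w: "cmod w \<le> 1" and y: "cmod y \<le> 1" and x: "cmod x \<le> 1"
  defines "r \<equiv> cmod x"
  defines "c1 \<equiv> x" and "c2 \<equiv> of_real (1 - r\<^sup>2) * y"
    and "c3 \<equiv> of_real (1 - r\<^sup>2) * (of_real (1 - (cmod y)\<^sup>2) * w - cnj x * y\<^sup>2)"
  obtains y' where "cmod y' = cmod y"
    "cmod (c3 + of_real \<mu> * c1 * c2 + of_real \<nu> * c1 ^ 3)
      \<le> r * cmod (of_real (1 - r\<^sup>2) * (- (y'\<^sup>2) + of_real \<bar>\<mu>\<bar> * y') + of_real (\<nu> * r\<^sup>2))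
         + (1 - r\<^sup>2) * (1 - (cmod y')\<^sup>2)"
proof -
  define u where "u = cis (Arg x)"
  have xu: "x = of_real r * u" by (simp add: u_def r_def rcis_cmod_Arg flip: rcis_def)
  have u: "cmod u = 1" "cnj u * u = 1" by (simp_all add: u_def cis_cnj cis_mult)
  define \<sigma> where "\<sigma> = (if 0 \<le> \<mu> then 1 else - 1 :: real)"
  have \<sigma>: "\<sigma> * \<sigma> = 1" "\<bar>\<mu>\<bar> = \<sigma> * \<mu>" "\<bar>\<sigma>\<bar> = 1" by (auto simp: \<sigma>_def)
  define y' where "y' = of_real \<sigma> * y * (cnj u)\<^sup>2"
  have y': "cmod y' = cmod y" using u \<sigma> by (simp add: y'_def norm_mult norm_power)
  have yy': "y = of_real \<sigma> * y' * u\<^sup>2"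
  proof -
    have "of_real \<sigma> * y' * u\<^sup>2 = of_real (\<sigma> * \<sigma>) * y * (cnj u * u)\<^sup>2"
      by (simp add: y'_def power_mult_distrib)
    then show ?thesis using u \<sigma> by simp
  qed
  have \<sigma>c: "of_real \<sigma> * of_real \<sigma> = (1 :: complex)" using \<sigma> by (simp flip: of_real_mult)
  have a: "cnj x * y\<^sup>2 = u ^ 3 * (of_real r * y'\<^sup>2)"
  proof -
    have "cnj x * y\<^sup>2 = of_real r * (cnj u * u) * (of_real \<sigma> * of_real \<sigma>) * y'\<^sup>2 * u ^ 3"
      unfolding xu yy' by (simp add: power2_eq_square power3_eq_cube mult_ac)
    then show ?thesis unfolding u \<sigma>c by simp
  qed
  have b: "of_real \<mu> * x * y = u ^ 3 * (of_real r * of_real \<bar>\<mu>\<bar> * y')"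
    unfolding xu yy' \<sigma> by (simp add: power2_eq_square power3_eq_cube mult_ac)
  have c: "x ^ 3 = u ^ 3 * (of_real r * of_real (r\<^sup>2))"
    unfolding xu by (simp add: power2_eq_square power3_eq_cube mult_ac)
  have T: "0 \<le> 1 - r\<^sup>2" "0 \<le> 1 - (cmod y)\<^sup>2" using x y by (auto simp: r_def power_le_one)
  have "c3 + of_real \<mu> * c1 * c2 + of_real \<nu> * c1 ^ 3
      = of_real (1 - r\<^sup>2) * (of_real \<mu> * x * y - cnj x * y\<^sup>2) + of_real \<nu> * x ^ 3
        + of_real ((1 - r\<^sup>2) * (1 - (cmod y)\<^sup>2)) * w"
    by (simp add: c1_def c2_def c3_def algebra_simps)
  also have "\<dots> = u ^ 3 * (of_real r * (of_real (1 - r\<^sup>2) * (- (y'\<^sup>2) + of_real \<bar>\<mu>\<bar> * y') + of_real (\<nu> * r\<^sup>2)))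
        + of_real ((1 - r\<^sup>2) * (1 - (cmod y)\<^sup>2)) * w"
    unfolding a b c by (simp add: algebra_simps)
  also have "cmod \<dots> \<le> cmod (u ^ 3 * (of_real r * (of_real (1 - r\<^sup>2) * (- (y'\<^sup>2) + of_real \<bar>\<mu>\<bar> * y') + of_real (\<nu> * r\<^sup>2))))
        + cmod (of_real ((1 - r\<^sup>2) * (1 - (cmod y)\<^sup>2)) * w)"
    by (rule norm_triangle_ineq)
  also have "cmod (u ^ 3 * (of_real r * (of_real (1 - r\<^sup>2) * (- (y'\<^sup>2) + of_real \<bar>\<mu>\<bar> * y') + of_real (\<nu> * r\<^sup>2))))
      = r * cmod (of_real (1 - r\<^sup>2) * (- (y'\<^sup>2) + of_real \<bar>\<mu>\<bar> * y') + of_real (\<nu> * r\<^sup>2))"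
    unfolding norm_mult norm_power u by (simp add: r_def)
  also have "cmod (of_real ((1 - r\<^sup>2) * (1 - (cmod y)\<^sup>2)) * w) \<le> (1 - r\<^sup>2) * (1 - (cmod y)\<^sup>2)"
    using mult_left_le[OF w, of "(1 - r\<^sup>2) * (1 - (cmod y)\<^sup>2)"] T
    unfolding norm_mult norm_of_real by (simp add: abs_of_nonneg)
  finally show thesis using that y' by simp
qed

lemma cubic_functional_bounds:
  fixes x y w :: complex and \<mu> \<nu> s :: real
  assumes xyw: "cmod x \<le> 1" "cmod y \<le> 1" "cmod w \<le> 1" and \<nu>: "\<nu> \<le> \<mu>\<^sup>2 / 4"
    and s: "0 \<le> s" "0 < \<bar>\<mu>\<bar> + 1 + \<nu>" "3 * (\<bar>\<mu>\<bar> + 1 + \<nu>) * s\<^sup>2 = \<bar>\<mu>\<bar> + 1"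
  defines "\<Phi> \<equiv> cmod (of_real (1 - (cmod x)\<^sup>2) * (of_real (1 - (cmod y)\<^sup>2) * w - cnj x * y\<^sup>2)
         + of_real \<mu> * x * (of_real (1 - (cmod x)\<^sup>2) * y) + of_real \<nu> * x ^ 3)"
  shows "\<nu> \<le> 1 \<or> \<nu> * (\<mu>\<^sup>2 + 2 * \<bar>\<mu>\<bar> + 4) \<le> 2 * \<bar>\<mu>\<bar> * (\<bar>\<mu>\<bar> + 1) \<Longrightarrow> \<Phi> \<le> max 1 (2/3 * (\<bar>\<mu>\<bar> + 1) * s)"
    and "1 \<le> \<nu> \<Longrightarrow> (\<mu>\<^sup>2 + 8) / 12 \<le> \<nu> \<Longrightarrow> \<Phi> \<le> max \<nu> (2/3 * (\<bar>\<mu>\<bar> + 1) * s)"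
proof -
  obtain y' where y': "cmod y' = cmod y" and le: "\<Phi> \<le> cmod x * cmod (of_real (1 - (cmod x)\<^sup>2) * (- (y'\<^sup>2) + of_real \<bar>\<mu>\<bar> * y') + of_real (\<nu> * (cmod x)\<^sup>2))
         + (1 - (cmod x)\<^sup>2) * (1 - (cmod y')\<^sup>2)"
    unfolding \<Phi>_def by (rule cubic_functional_le[OF xyw(3,2,1)])
  have y1: "cmod y' \<le> 1" using xyw y' by simp
  have \<nu>': "\<nu> \<le> \<bar>\<mu>\<bar>\<^sup>2 / 4" using \<nu> by simp
  note b = coefficient_value_le[OF norm_ge_zero xyw(1) y1 abs_ge_zero \<nu>' s]
  show "\<nu> \<le> 1 \<or> \<nu> * (\<mu>\<^sup>2 + 2 * \<bar>\<mu>\<bar> + 4) \<le> 2 * \<bar>\<mu>\<bar> * (\<bar>\<mu>\<bar> + 1) \<Longrightarrow> \<Phi> \<le> max 1 (2/3 * (\<bar>\<mu>\<bar> + 1) * s)"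
    by (rule order_trans[OF le b(1)]) simp
  show "1 \<le> \<nu> \<Longrightarrow> (\<mu>\<^sup>2 + 8) / 12 \<le> \<nu> \<Longrightarrow> \<Phi> \<le> max \<nu> (2/3 * (\<bar>\<mu>\<bar> + 1) * s)"
    by (rule order_trans[OF le b(2)]) simp_all
qed

lemma quadratic_functional_le:
  assumes "cmod x \<le> 1" "cmod y \<le> 1"
  shows "cmod (of_real (1 - (cmod x)\<^sup>2) * y - of_real t * x\<^sup>2) \<le> max 1 \<bar>t\<bar>"
proof -
  have T: "0 \<le> 1 - (cmod x)\<^sup>2" using assms by (simp add: power_le_one)
  have "cmod (of_real (1 - (cmod x)\<^sup>2) * y - of_real t * x\<^sup>2)
      \<le> cmod (of_real (1 - (cmod x)\<^sup>2) * y) + cmod (of_real t * x\<^sup>2)"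
    by (rule norm_triangle_ineq4)
  also have "\<dots> = (1 - (cmod x)\<^sup>2) * cmod y + (cmod x)\<^sup>2 * \<bar>t\<bar>"
    unfolding norm_mult norm_of_real norm_power using T by (simp add: abs_of_nonneg)
  also have "\<dots> \<le> (1 - (cmod x)\<^sup>2) * max 1 \<bar>t\<bar> + (cmod x)\<^sup>2 * max 1 \<bar>t\<bar>"
    using T assms by (intro add_mono mult_left_mono) auto
  also have "\<dots> = max 1 \<bar>t\<bar>" by (simp add: algebra_simps)
  finally show ?thesis .
qed

text \<open>
  Here \<open>(2/3 m s)\<^sup>2 = 4/27 m\<^sup>3 / K\<close>. In this form the curves bounding \<open>D2\<close> and \<open>D8\<close> become
  comparisons of \<open>2/3 m s\<close> with \<open>1\<close>.
\<close>

lemma critical_bound_sqrt: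
  fixes K m s u :: real
  assumes "0 < K" "0 \<le> m" "3 * K * s\<^sup>2 = m" "0 \<le> s" "0 \<le> u"
  shows "4/27 * m ^ 3 \<le> u\<^sup>2 * K \<longleftrightarrow> 2/3 * m * s \<le> u"
proof -
  have m: "m = 3 * K * s\<^sup>2" using assms by simp
  have e: "4/27 * m ^ 3 = (2/3 * m * s)\<^sup>2 * K"
    unfolding m by (simp add: power2_eq_square power3_eq_cube)
  have "4/27 * m ^ 3 \<le> u\<^sup>2 * K \<longleftrightarrow> (2/3 * m * s)\<^sup>2 \<le> u\<^sup>2"
    unfolding e using assms(1) by simp
  also have "\<dots> \<longleftrightarrow> 2/3 * m * s \<le> u"
    using assms by (intro abs_le_square_iff[symmetric, THEN trans]) (simp add: abs_of_nonneg)
  finally show ?thesis .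
qed

text \<open>
  The right-hand side increases with \<open>\<nu>\<close>. On the boundary curve \<open>\<nu> = (m\<^sup>2 + 8) / 12\<close> the two
  sides and their first derivatives agree at \<open>m = 2\<close>; the difference, expanded in powers of
  \<open>t = m - 2\<close>, has only positive coefficients from order two on.
\<close>

lemma D6_cubic_le:
  fixes m \<nu> :: real
  assumes m: "2 \<le> m" and \<nu>: "(m\<^sup>2 + 8) / 12 \<le> \<nu>"
  shows "4/27 * (m + 1) ^ 3 \<le> \<nu>\<^sup>2 * (m + 1 + \<nu>)"
proof -
  define t n where "t = m - 2" and "n = (m\<^sup>2 + 8) / 12"
  have m': "m = t + 2" "0 \<le> t" using m by (auto simp: t_def)
  have "1728 * (n\<^sup>2 * (m + 1 + n) - 4/27 * (m + 1) ^ 3)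
      = t ^ 2 * (1296 + 864 * t + 216 * t\<^sup>2 + 24 * t ^ 3 + t ^ 4)"
    unfolding n_def m' by (simp add: power2_eq_square power3_eq_cube power4_eq_xxxx field_simps)
  also have "\<dots> \<ge> 0" using m' by simp
  finally have "4/27 * (m + 1) ^ 3 \<le> n\<^sup>2 * (m + 1 + n)" by (simp add: mult_ac)
  also have "\<dots> \<le> \<nu>\<^sup>2 * (m + 1 + \<nu>)"
    using \<nu> m by (intro mult_mono power_mono) (auto simp: n_def)
  finally show ?thesis .
qed

lemma sharp_boundI:
  assumes "\<And>f. f \<in> S \<Longrightarrow> F f \<le> b" and "f \<in> S" "F f = b"
  shows "sharp_bound S F b"
  using assms unfolding sharp_bound_def by blast

section \<open>The sharp estimates\<close>

theorem theorem3p1: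
  fixes A B \<mu> \<nu> :: real
  assumes "-1 \<le> B" and "B < A" and "A \<le> 1"
    and "\<mu> = (B - 5 * A) / 2"
    and "\<nu> = (3 * A^2 - A * B) / 2"
  shows
    "sharp_bound (janowski_convex A B) (\<lambda>f. cmod (log_inverse_coeff f 1)) ((A - B) / 4)
     \<and> (\<bar>5 * A - B\<bar> \<le> 4 \<longrightarrow>
         sharp_bound (janowski_convex A B) (\<lambda>f. cmod (log_inverse_coeff f 2)) ((A - B) / 12))
     \<and> (\<bar>5 * A - B\<bar> > 4 \<longrightarrow>
         sharp_bound (janowski_convex A B) (\<lambda>f. cmod (log_inverse_coeff f 2))
           ((A - B) * \<bar>5 * A - B\<bar> / 48))
     \<and> ((\<mu>, \<nu>) \<in> D1 \<union> D2 \<longrightarrow>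
         sharp_bound (janowski_convex A B) (\<lambda>f. cmod (log_inverse_coeff f 3)) ((A - B) / 24))
     \<and> ((\<mu>, \<nu>) \<in> D6 \<longrightarrow>
         sharp_bound (janowski_convex A B) (\<lambda>f. cmod (log_inverse_coeff f 3))
           ((A - B) * \<bar>A * (3 * A - B)\<bar> / 48))
     \<and> ((\<mu>, \<nu>) \<in> D8 \<union> D9 \<longrightarrow>
         sharp_bound (janowski_convex A B) (\<lambda>f. cmod (log_inverse_coeff f 3))
           ((A - B) * (\<bar>B - 5 * A\<bar> + 2) powr (3/2)
             / (72 * sqrt (3 * (\<bar>B - 5 * A\<bar> + 2 + 3 * A^2 - A * B)))))"
proof -
  have A: "\<bar>A\<bar> \<le> 1" and B: "\<bar>B\<bar> \<le> 1" and BA: "B < A" using assms by auto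
  define d where "d = A - B"
  have d: "0 < d" "d \<le> 2" using assms by (auto simp: d_def)
  define t where "t = (5 * A - B) / 4"
  let ?\<Phi> = "\<lambda>x y w. cmod (of_real (1 - (cmod x)\<^sup>2) * (of_real (1 - (cmod y)\<^sup>2) * w - cnj x * y\<^sup>2)
         + of_real \<mu> * x * (of_real (1 - (cmod x)\<^sup>2) * y) + of_real \<nu> * x ^ 3)"
  note coeffs = janowski_coeffs[OF A B BA, folded d_def t_def assms(4,5)]
  note attained = janowski_coeffs_attained[OF A B BA, folded d_def t_def assms(4,5)]
  \<comment> \<open>\<open>f1\<close>, \<open>f2\<close>, \<open>f3\<close> belong to the Schwarz functions \<open>z\<close>, \<open>z\<^sup>2\<close>, \<open>z\<^sup>3\<close>\<close>
  obtain f1 where f1: "f1 \<in> janowski_convex A B" "cmod (log_inverse_coeff f1 1) = d / 4"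
    "cmod (log_inverse_coeff f1 2) = d / 12 * \<bar>t\<bar>" "cmod (log_inverse_coeff f1 3) = d / 24 * \<bar>\<nu>\<bar>"
    by (rule attained[OF power_coeffs(1-3)[of 1]]) (simp_all add: power_coeffs(4)[of 1, simplified])
  obtain f2 where f2: "f2 \<in> janowski_convex A B" "cmod (log_inverse_coeff f2 2) = d / 12"
    by (rule attained[OF power_coeffs(1-3)[of 2]]) (simp_all add: power_coeffs(4)[of 2, simplified])
  obtain f3 where f3: "f3 \<in> janowski_convex A B" "cmod (log_inverse_coeff f3 3) = d / 24"
    by (rule attained[OF power_coeffs(1-3)[of 3]]) (simp_all add: power_coeffs(4)[of 3, simplified])

  have \<Gamma>1: "cmod (log_inverse_coeff f 1) \<le> d / 4" if "f \<in> janowski_convex A B" for f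
    by (rule coeffs[OF that]) (use d in \<open>simp add: mult_left_le\<close>)
  have \<Gamma>2: "cmod (log_inverse_coeff f 2) \<le> d / 12 * max 1 \<bar>t\<bar>" if "f \<in> janowski_convex A B" for f
    by (rule coeffs[OF that]) (use d quadratic_functional_le in \<open>simp only: mult_left_mono\<close>)

  \<comment> \<open>the pairs \<open>(\<mu>, \<nu>)\<close> that occur fill only a strip below the parabola \<open>\<nu> = \<mu>\<^sup>2 / 4\<close>\<close>
  have \<nu>_eq: "\<nu> = \<mu>\<^sup>2 / 4 - d\<^sup>2 / 16"
    unfolding assms d_def by (simp add: power2_eq_square field_simps)
  have "d\<^sup>2 \<le> 2\<^sup>2" using d by (intro power_mono) auto
  then have \<nu>: "\<nu> \<le> \<mu>\<^sup>2 / 4" "\<mu>\<^sup>2 / 4 - 1 / 4 \<le> \<nu>" using \<nu>_eq by auto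
  have \<mu>2: "0 \<le> \<mu>\<^sup>2" by simp
  define m K s M where "m = \<bar>\<mu>\<bar> + 1" and "K = \<bar>\<mu>\<bar> + 1 + \<nu>" and "s = sqrt (m / (3 * K))"
    and "M = 2/3 * m * s"
  have m: "1 \<le> m" by (simp add: m_def)
  have K: "0 < K" using \<nu> \<mu>2 unfolding K_def by linarith
  have s: "0 \<le> s" "3 * K * s\<^sup>2 = m" using K m by (auto simp: s_def)
  note M_le = critical_bound_sqrt[OF K _ s(2,1), folded M_def]
  have K': "0 < \<bar>\<mu>\<bar> + 1 + \<nu>" and s': "3 * (\<bar>\<mu>\<bar> + 1 + \<nu>) * s\<^sup>2 = \<bar>\<mu>\<bar> + 1"
    using K s by (auto simp: K_def m_def)
  have \<Gamma>3: "cmod (log_inverse_coeff f 3) \<le> d / 24 * b"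
    if "f \<in> janowski_convex A B"
      and "\<And>x y w. cmod x \<le> 1 \<Longrightarrow> cmod y \<le> 1 \<Longrightarrow> cmod w \<le> 1 \<Longrightarrow> ?\<Phi> x y w \<le> b" for f b
    by (rule coeffs[OF that(1)]) (use d that(2) in \<open>simp only: mult_left_mono\<close>)
  note \<Phi> = cubic_functional_bounds[OF _ _ _ \<nu>(1) s(1) K' s', folded m_def, folded M_def]
  note \<Gamma>3a = \<Gamma>3[OF _ \<Phi>(1)] and \<Gamma>3b = \<Gamma>3[OF _ \<Phi>(2)]

  have 1: "sharp_bound (janowski_convex A B) (\<lambda>f. cmod (log_inverse_coeff f 1)) (d / 4)"
    using \<Gamma>1 f1 by (intro sharp_boundI)
  have 2: "sharp_bound (janowski_convex A B) (\<lambda>f. cmod (log_inverse_coeff f 2)) (d / 12)"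
    if "\<bar>5 * A - B\<bar> \<le> 4"
  proof -
    have "max 1 \<bar>t\<bar> = 1" using that by (simp add: t_def)
    then show ?thesis using \<Gamma>2 f2 by (intro sharp_boundI) auto
  qed
  have 3: "sharp_bound (janowski_convex A B) (\<lambda>f. cmod (log_inverse_coeff f 2)) (d * \<bar>5 * A - B\<bar> / 48)"
    if "\<bar>5 * A - B\<bar> > 4"
  proof -
    have t: "max 1 \<bar>t\<bar> = \<bar>t\<bar>" "d * \<bar>5 * A - B\<bar> / 48 = d / 12 * \<bar>t\<bar>" using that by (auto simp: t_def)
    show ?thesis unfolding t(2) using \<Gamma>2[unfolded t(1)] f1 by (intro sharp_boundI)
  qed
  have 4: "sharp_bound (janowski_convex A B) (\<lambda>f. cmod (log_inverse_coeff f 3)) (d / 24)"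
    if D: "(\<mu>, \<nu>) \<in> D1 \<union> D2"
  proof -
    have \<nu>1: "\<nu> \<le> 1" using D by (auto simp: D1_def D2_def)
    have "4/27 * m ^ 3 \<le> K"
    proof (cases "(\<mu>, \<nu>) \<in> D2")
      case True
      then show ?thesis by (auto simp: D2_def m_def K_def)
    next
      case False
      then have "m \<le> 3/2" using D by (auto simp: D1_def m_def)
      then have "m\<^sup>2 \<le> (3/2)\<^sup>2" using m by (intro power_mono) auto
      then have "m * m\<^sup>2 \<le> m * (3/2)\<^sup>2" using m by (intro mult_left_mono) auto
      then have "m ^ 3 \<le> 9/4 * m" by (simp add: power3_eq_cube power2_eq_square)
      moreover have "m - 1/4 \<le> K" using \<nu> \<mu>2 unfolding K_def m_def by linarith
      ultimately show ?thesis using m by linarith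
    qed
    then have "M \<le> 1" using M_le[of 1] m by simp
    then have "max 1 M = 1" by simp
    then show ?thesis using \<Gamma>3a \<nu>1 f3 by (intro sharp_boundI) auto
  qed
  have 5: "sharp_bound (janowski_convex A B) (\<lambda>f. cmod (log_inverse_coeff f 3)) (d * \<bar>A * (3 * A - B)\<bar> / 48)"
    if D: "(\<mu>, \<nu>) \<in> D6"
  proof -
    have \<mu>D: "2 \<le> \<bar>\<mu>\<bar>" and \<nu>D: "(\<mu>\<^sup>2 + 8) / 12 \<le> \<nu>" using D by (auto simp: D6_def)
    have "2\<^sup>2 \<le> \<bar>\<mu>\<bar>\<^sup>2" using \<mu>D by (intro power_mono) auto
    then have \<nu>1: "1 \<le> \<nu>" using \<nu>D by simp
    have "4/27 * m ^ 3 \<le> \<nu>\<^sup>2 * K" unfolding m_def K_def by (rule D6_cubic_le) (use \<mu>D \<nu>D in auto)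
    then have "M \<le> \<nu>" using M_le[of \<nu>] m \<nu>1 by simp
    then have max: "max \<nu> M = \<nu>" by simp
    have "A * (3 * A - B) = 2 * \<nu>" unfolding assms by (simp add: power2_eq_square algebra_simps)
    then have b: "d * \<bar>A * (3 * A - B)\<bar> / 48 = d / 24 * \<nu>" using \<nu>1 by simp
    show ?thesis unfolding b
      using \<Gamma>3b \<nu>1 \<nu>D f1 max by (intro sharp_boundI[where f = f1]) auto
  qed
  have 6: "sharp_bound (janowski_convex A B) (\<lambda>f. cmod (log_inverse_coeff f 3)) (d / 24 * M)"
    if D: "(\<mu>, \<nu>) \<in> D8 \<union> D9"
  proof -
    have low: "- 2/3 * m \<le> \<nu>" using D by (auto simp: D8_def D9_def m_def)
    have "K = m + \<nu>" by (simp add: K_def m_def)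
    with low have "m \<le> 3 * K" by linarith
    then have "s\<^sup>2 * (3 * K) \<le> 1 * (3 * K)" using s(2) by (simp add: mult_ac)
    then have "s\<^sup>2 \<le> 1\<^sup>2" using K by simp
    then have s1: "s \<le> 1" by (rule power2_le_imp_le) simp
    have dec: "\<nu> \<le> 1 \<or> \<nu> * (\<mu>\<^sup>2 + 2 * \<bar>\<mu>\<bar> + 4) \<le> 2 * \<bar>\<mu>\<bar> * m" and K_le: "K \<le> 4/27 * m ^ 3"
    proof -
      have "\<nu> \<le> 1 \<and> K \<le> 4/27 * m ^ 3" if "(\<mu>, \<nu>) \<in> D8"
      proof -
        have "\<bar>\<mu>\<bar>\<^sup>2 \<le> 2\<^sup>2" using that by (intro power_mono) (auto simp: D8_def)
        then show ?thesis using that \<nu> by (auto simp: D8_def K_def m_def)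
      qed
      moreover have "\<nu> * (\<mu>\<^sup>2 + 2 * \<bar>\<mu>\<bar> + 4) \<le> 2 * \<bar>\<mu>\<bar> * m \<and> K \<le> 4/27 * m ^ 3" if "(\<mu>, \<nu>) \<in> D9"
      proof -
        define q where "q = \<mu>\<^sup>2 + 2 * \<bar>\<mu>\<bar> + 4"
        have q: "0 < q" by (simp add: q_def add_nonneg_pos)
        have "\<nu> \<le> 2 * \<bar>\<mu>\<bar> * m / q" using that by (simp add: D9_def q_def m_def)
        then have *: "\<nu> * q \<le> 2 * \<bar>\<mu>\<bar> * m" using q by (simp add: pos_le_divide_eq)
        \<comment> \<open>\<open>K \<le> 4/3 m \<le> 4/27 m\<^sup>3\<close>, where the first inequality means \<open>\<nu> \<le> m / 3\<close>\<close>
        have "0 \<le> (\<bar>\<mu>\<bar> - 2)\<^sup>2" by simp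
        then have "6 * \<bar>\<mu>\<bar> \<le> q" by (simp add: q_def power2_eq_square algebra_simps)
        then have "2 * \<bar>\<mu>\<bar> * m \<le> m / 3 * q" using m by (simp add: mult.commute mult_right_mono)
        with * have "\<nu> * q \<le> m / 3 * q" by linarith
        then have "\<nu> \<le> m / 3" using q by simp
        moreover have "3\<^sup>2 \<le> m\<^sup>2" using that by (intro power_mono) (auto simp: D9_def m_def)
        then have "m * 3\<^sup>2 \<le> m * m\<^sup>2" using m by (intro mult_left_mono) auto
        ultimately have "K \<le> 4/27 * m ^ 3" by (simp add: K_def m_def[symmetric] power2_eq_square power3_eq_cube)
        with * show ?thesis by (simp add: q_def)
      qed
      ultimately show "\<nu> \<le> 1 \<or> \<nu> * (\<mu>\<^sup>2 + 2 * \<bar>\<mu>\<bar> + 4) \<le> 2 * \<bar>\<mu>\<bar> * m" "K \<le> 4/27 * m ^ 3"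
        using D by auto
    qed
    have "1 \<le> M"
    proof (rule ccontr)
      assume "\<not> 1 \<le> M"
      moreover have M0: "0 \<le> M" using m s by (simp add: M_def)
      ultimately have "M\<^sup>2 < 1" by (simp add: abs_square_less_1)
      then have "M\<^sup>2 * K < 1 * K" using K by (intro mult_strict_right_mono)
      moreover have "4/27 * m ^ 3 \<le> M\<^sup>2 * K" using M_le[of M] M0 m by simp
      ultimately show False using K_le by linarith
    qed
    then have max: "max 1 M = M" by simp
    \<comment> \<open>the sign for which both \<open>c\<^sub>3\<close> and \<open>\<mu> c\<^sub>1 c\<^sub>2\<close> are nonpositive\<close>
    define \<sigma> where "\<sigma> = (if 0 \<le> \<mu> then - 1 else 1 :: real)"
    have \<sigma>: "\<sigma> * \<sigma> = 1" "\<mu> * \<sigma> = - \<bar>\<mu>\<bar>" by (auto simp: \<sigma>_def)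
    note bl = Blaschke_coeffs[OF s(1) s1 \<sigma>(1)]
    obtain f4 where f4: "f4 \<in> janowski_convex A B"
      "cmod (log_inverse_coeff f4 3) = d / 24 * cmod (of_real (- (1 - s\<^sup>2) * s) +
          of_real \<mu> * of_real s * of_real ((1 - s\<^sup>2) * \<sigma>) + of_real \<nu> * of_real s ^ 3)"
      by (rule attained[OF bl(1-3)]) (simp only: bl(4-6))
    have "of_real (- (1 - s\<^sup>2) * s) + of_real \<mu> * of_real s * of_real ((1 - s\<^sup>2) * \<sigma>) + of_real \<nu> * of_real s ^ 3
        = complex_of_real (- (1 - s\<^sup>2) * s + s * (1 - s\<^sup>2) * (\<mu> * \<sigma>) + \<nu> * s ^ 3)"
      by (simp add: mult_ac)
    also have "- (1 - s\<^sup>2) * s + s * (1 - s\<^sup>2) * (\<mu> * \<sigma>) + \<nu> * s ^ 3 = - (m * s - (3 * K * s\<^sup>2) * s / 3)"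
      unfolding \<sigma>(2) by (simp add: K_def m_def power2_eq_square power3_eq_cube algebra_simps)
    also have "\<dots> = - M" unfolding s by (simp add: M_def)
    finally have "cmod (log_inverse_coeff f4 3) = d / 24 * M"
      using f4(2) \<open>1 \<le> M\<close> by simp
    then show ?thesis
      using \<Gamma>3a dec max f4(1) by (intro sharp_boundI[where f = f4]) auto
  qed
  have q: "\<bar>B - 5 * A\<bar> + 2 = 2 * m" "\<bar>B - 5 * A\<bar> + 2 + 3 * A^2 - A * B = 2 * K"
    unfolding m_def K_def assms by (auto simp: field_simps)
  have "(2 * m) powr (3/2) = (2 * m) powr (1 + 1/2)" by simp
  also have "\<dots> = 2 * m * sqrt (2 * m)" using m by (subst powr_add) (simp add: powr_half_sqrt)
  also have "sqrt (2 * m) = sqrt (3 * (2 * K)) * s"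
    unfolding s_def real_sqrt_mult[symmetric] using K by simp
  finally have X: "(2 * m) powr (3/2) / sqrt (3 * (2 * K)) = 2 * m * s"
    using K by simp
  have "d * (2 * m) powr (3/2) / (72 * sqrt (3 * (2 * K))) = d / 72 * ((2 * m) powr (3/2) / sqrt (3 * (2 * K)))"
    by simp
  also have "\<dots> = d / 24 * M" unfolding X M_def by simp
  finally have b: "d * (\<bar>B - 5 * A\<bar> + 2) powr (3/2) / (72 * sqrt (3 * (\<bar>B - 5 * A\<bar> + 2 + 3 * A^2 - A * B))) = d / 24 * M"
    unfolding q(2) unfolding q(1) .
  show ?thesis
    unfolding d_def[symmetric] b using 1 2 3 4 5 6 by blast
qed

end
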